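(* Let $\mathfrak g$ be a Kac--Moody algebra. For every $\lambda\in\mathfrak h^*$ one has $$\operatorname{wt}L(\lambda)=\operatorname{conv}L(\lambda)\cap\{\mu\in\mathfrak h^*:\mu\leqslant\lambda\}.$$
   Context: Let $I$ be a finite set, $A=(a_{ij})_{i,j\in I}$ a generalized Cartan matrix, and $(\mathfrak h,\{\alpha_i\},\{\check\alpha_i\})$ a realization over $\mathbb C$, i.e. $\dim\mathfrak h=2|I|-\operatorname{rk}A$, with linearly independent simple roots $\alpha_i\in\mathfrak h^*$ and linearly independent simple coroots $\check\alpha_i\in\mathfrak h$ with $\langle\check\alpha_i,\alpha_j\rangle=a_{ij}$. $\mathfrak g=\mathfrak g(A)$ is the Lie algebra generated by $\mathfrak h$ and $e_i,f_i$ ($i\in I$) with relations $[\mathfrak h,\mathfrak h]=0$, $[h,e_i]=\langle h,\alpha_i\rangle e_i$, $[h,f_i]=-\langle h,\alpha_i\rangle f_i$, $[e_i,f_j]=\delta_{ij}\check\alpha_i$ and the Serre relations $(\operatorname{ad}e_i)^{1-a_{ij}}e_j=0=(\operatorname{ad}f_i)^{1-a_{ij}}f_j$ for $i\ne j$. For an $\mathfrak h$-module $M$ and $\mu\in\mathfrak h^*$, $M_\mu=\{m: hm=\langle h,\mu\rangle m\ \forall h\in\mathfrak h\}$ and $\operatorname{wt}M=\{\mu: M_\mu\neq0\}$. $L(\lambda)$ is the simple highest weight $\mathfrak g$-module with highest weight $\lambda$. $\operatorname{conv}L(\lambda)$ is the convex hull (over $\mathbb R$) of $\operatorname{wt}L(\lambda)$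 in the real vector space underlying $\mathfrak h^*$. The partial order on $\mathfrak h^*$: $\mu\leqslant\lambda$ iff $\lambda-\mu$ is a (possibly empty) sum of simple roots, i.e. lies in $\mathbb Z^{\geqslant0}\{\alpha_i:i\in I\}$. *)

theory Defs
  imports "HOL-Analysis.Analysis" "HOL-Library.Function_Algebras"
begin

text \<open>The dual of a complex vector space is a set of functions into \<open>complex\<close>. The pointwise real
  scaling makes the library's \<open>convex hull\<close> available in its underlying real vector space.\<close>

instantiation "fun" :: (type, scaleR) scaleR
begin

definition scaleR_fun where "scaleR_fun r f = (\<lambda>x. r *\<^sub>R f x)"

instance ..

end

instance "fun" :: (type, real_vector) real_vector
  by standard (simp_all add: scaleR_fun_def plus_fun_def scaleR_right_distrib scaleR_left_distrib)

definition cfun_scale :: "complex \<Rightarrow> ('x \<Rightarrow> complex) \<Rightarrow> 'x \<Rightarrow> complex"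
  where "cfun_scale c f = (\<lambda>x. c * f x)"

definition dual :: "(complex \<Rightarrow> 'h \<Rightarrow> 'h) \<Rightarrow> ('h::ab_group_add \<Rightarrow> complex) set"
  where "dual hs = {\<mu>. Vector_Spaces.linear hs (*) \<mu>}"

locale generalized_cartan_matrix =
  fixes I :: "'i set" and A :: "'i \<Rightarrow> 'i \<Rightarrow> int"
  assumes finite_index: "finite I"
    and diagonal: "i \<in> I \<Longrightarrow> A i i = 2"
    and off_diagonal: "i \<in> I \<Longrightarrow> j \<in> I \<Longrightarrow> i \<noteq> j \<Longrightarrow> A i j \<le> 0"
    and zero_symmetric: "i \<in> I \<Longrightarrow> j \<in> I \<Longrightarrow> A i j = 0 \<Longrightarrow> A j i = 0"

text \<open>Row rank over the complex numbers; rows are extended by zero outside \<open>I\<close>.\<close>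

definition cartan_rank :: "'i set \<Rightarrow> ('i \<Rightarrow> 'i \<Rightarrow> int) \<Rightarrow> nat"
  where "cartan_rank I A =
    vector_space.dim cfun_scale ((\<lambda>i j. if j \<in> I then complex_of_int (A i j) else 0) ` I)"

text \<open>The whole type \<open>'h\<close>, with scalar multiplication \<open>hs\<close>, is the Cartan subalgebra.
  As \<open>dim\<close> is also 0 for infinite-dimensional spaces, finite dimension is required separately.\<close>

locale cartan_realization = generalized_cartan_matrix I A + vector_space hs
  for I :: "'i set" and A :: "'i \<Rightarrow> 'i \<Rightarrow> int"
    and hs :: "complex \<Rightarrow> 'h::ab_group_add \<Rightarrow> 'h" +
  fixes \<alpha> :: "'i \<Rightarrow> 'h \<Rightarrow> complex" and coroot :: "'i \<Rightarrow> 'h"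
  assumes finite_dim: "\<exists>B. finite B \<and> module.span hs B = UNIV"
    and dim_eq: "int (vector_space.dim hs (UNIV :: 'h set)) = 2 * int (card I) - int (cartan_rank I A)"
    and root_dual: "i \<in> I \<Longrightarrow> \<alpha> i \<in> dual hs"
    and roots_inj: "inj_on \<alpha> I"
    and roots_independent: "\<not> module.dependent cfun_scale (\<alpha> ` I)"
    and coroots_inj: "inj_on coroot I"
    and coroots_independent: "\<not> module.dependent hs (coroot ` I)"
    and pairing: "i \<in> I \<Longrightarrow> j \<in> I \<Longrightarrow> \<alpha> j (coroot i) = complex_of_int (A i j)"

locale lie_algebra = vector_space gs
  for gs :: "complex \<Rightarrow> 'g::ab_group_add \<Rightarrow> 'g" +
  fixes br :: "'g \<Rightarrow> 'g \<Rightarrow> 'g"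
  assumes bracket_linear_right: "Vector_Spaces.linear gs gs (br x)"
    and bracket_linear_left: "Vector_Spaces.linear gs gs (\<lambda>x. br x y)"
    and bracket_self: "br x x = 0"
    and jacobi: "br x (br y z) + br y (br z x) + br z (br x y) = 0"

datatype 'x lie_term =
    Gen 'x
  | Zero
  | Add "'x lie_term" "'x lie_term"
  | Scale complex "'x lie_term"
  | Bracket "'x lie_term" "'x lie_term"

primrec lie_eval ::
  "(complex \<Rightarrow> 'g \<Rightarrow> 'g) \<Rightarrow> ('g \<Rightarrow> 'g \<Rightarrow> 'g) \<Rightarrow> ('x \<Rightarrow> 'g::ab_group_add) \<Rightarrow> 'x lie_term \<Rightarrow> 'g"
where
  "lie_eval gs br gen (Gen x) = gen x"
| "lie_eval gs br gen Zero = 0"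
| "lie_eval gs br gen (Add s t) = lie_eval gs br gen s + lie_eval gs br gen t"
| "lie_eval gs br gen (Scale c t) = gs c (lie_eval gs br gen t)"
| "lie_eval gs br gen (Bracket s t) = br (lie_eval gs br gen s) (lie_eval gs br gen t)"

text \<open>The least congruence on terms that contains the pairs in \<open>R\<close> and the axioms of complex Lie
  algebras: \<open>s\<close> and \<open>t\<close> are related iff the relations \<open>R\<close> force them to be equal.\<close>

inductive lie_cong :: "('x lie_term \<times> 'x lie_term) set \<Rightarrow> 'x lie_term \<Rightarrow> 'x lie_term \<Rightarrow> bool"
  for R
where
  rel: "(s, t) \<in> R \<Longrightarrow> lie_cong R s t"
| refl: "lie_cong R t t"
| sym: "lie_cong R s t \<Longrightarrow> lie_cong R t s"
| trans: "lie_cong R s t \<Longrightarrow> lie_cong R t u \<Longrightarrow> lie_cong R s u"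
| add_cong: "lie_cong R s s' \<Longrightarrow> lie_cong R t t' \<Longrightarrow> lie_cong R (Add s t) (Add s' t')"
| scale_cong: "lie_cong R t t' \<Longrightarrow> lie_cong R (Scale c t) (Scale c t')"
| bracket_cong: "lie_cong R s s' \<Longrightarrow> lie_cong R t t' \<Longrightarrow> lie_cong R (Bracket s t) (Bracket s' t')"
| add_assoc: "lie_cong R (Add (Add s t) u) (Add s (Add t u))"
| add_commute: "lie_cong R (Add s t) (Add t s)"
| add_zero: "lie_cong R (Add Zero t) t"
| add_neg: "lie_cong R (Add t (Scale (- 1) t)) Zero"
| scale_add: "lie_cong R (Scale c (Add s t)) (Add (Scale c s) (Scale c t))"
| add_scale: "lie_cong R (Scale (c + d) t) (Add (Scale c t) (Scale d t))"
| scale_scale: "lie_cong R (Scale c (Scale d t)) (Scale (c * d) t)"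
| scale_one: "lie_cong R (Scale 1 t) t"
| bracket_add_left: "lie_cong R (Bracket (Add s t) u) (Add (Bracket s u) (Bracket t u))"
| bracket_add_right: "lie_cong R (Bracket s (Add t u)) (Add (Bracket s t) (Bracket s u))"
| bracket_scale_left: "lie_cong R (Bracket (Scale c s) t) (Scale c (Bracket s t))"
| bracket_scale_right: "lie_cong R (Bracket s (Scale c t)) (Scale c (Bracket s t))"
| bracket_self: "lie_cong R (Bracket t t) Zero"
| jacobi: "lie_cong R
    (Add (Bracket s (Bracket t u)) (Add (Bracket t (Bracket u s)) (Bracket u (Bracket s t)))) Zero"

text \<open>The Lie algebra \<open>'g\<close> is the one generated by \<open>gen ` X\<close> subject to the relations \<open>R\<close>: these
  elements generate it, and an identity between Lie words in them holds iff it follows from \<open>R\<close>.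
  This is the quotient of the free Lie algebra on \<open>X\<close> by the ideal given by \<open>R\<close>, up to unique
  isomorphism. Generators outside \<open>X\<close> may occur inside a derivation of \<open>lie_cong\<close>; if \<open>R\<close> only
  mentions generators in \<open>X\<close>, they can be replaced by \<open>Zero\<close> throughout.\<close>

locale presented_lie_algebra = lie_algebra gs br
  for gs :: "complex \<Rightarrow> 'g::ab_group_add \<Rightarrow> 'g" and br :: "'g \<Rightarrow> 'g \<Rightarrow> 'g" +
  fixes X :: "'x set" and R :: "('x lie_term \<times> 'x lie_term) set" and gen :: "'x \<Rightarrow> 'g"
  assumes generated: "lie_eval gs br gen ` {t. set_lie_term t \<subseteq> X} = UNIV"
    and eval_eq_iff: "set_lie_term s \<subseteq> X \<Longrightarrow> set_lie_term t \<subseteq> X \<Longrightarrow>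
      lie_eval gs br gen s = lie_eval gs br gen t \<longleftrightarrow> lie_cong R s t"

datatype ('h, 'i) km_gen = Cartan 'h | E 'i | F 'i

definition km_generators :: "'i set \<Rightarrow> ('h, 'i) km_gen set"
  where "km_generators I = range Cartan \<union> E ` I \<union> F ` I"

text \<open>\<open>cartan_add\<close> and \<open>cartan_scale\<close> express that the Cartan subalgebra enters as a vector space,
  i.e. that it is mapped linearly to the Lie algebra.\<close>

inductive_set km_relations ::
  "'i set \<Rightarrow> ('i \<Rightarrow> 'i \<Rightarrow> int) \<Rightarrow> (complex \<Rightarrow> 'h \<Rightarrow> 'h) \<Rightarrow> ('i \<Rightarrow> 'h \<Rightarrow> complex) \<Rightarrow> ('i \<Rightarrow> 'h::ab_group_add) \<Rightarrow>
    (('h, 'i) km_gen lie_term \<times> ('h, 'i) km_gen lie_term) set"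
  for I A hs \<alpha> coroot
where
  cartan_add: "(Gen (Cartan (h + h')), Add (Gen (Cartan h)) (Gen (Cartan h')))
    \<in> km_relations I A hs \<alpha> coroot"
| cartan_scale: "(Gen (Cartan (hs c h)), Scale c (Gen (Cartan h))) \<in> km_relations I A hs \<alpha> coroot"
| cartan_cartan: "(Bracket (Gen (Cartan h)) (Gen (Cartan h')), Zero) \<in> km_relations I A hs \<alpha> coroot"
| cartan_E: "i \<in> I \<Longrightarrow>
    (Bracket (Gen (Cartan h)) (Gen (E i)), Scale (\<alpha> i h) (Gen (E i)))
    \<in> km_relations I A hs \<alpha> coroot"
| cartan_F: "i \<in> I \<Longrightarrow>
    (Bracket (Gen (Cartan h)) (Gen (F i)), Scale (- \<alpha> i h) (Gen (F i)))
    \<in> km_relations I A hs \<alpha> coroot"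
| E_F: "i \<in> I \<Longrightarrow> j \<in> I \<Longrightarrow>
    (Bracket (Gen (E i)) (Gen (F j)), if i = j then Gen (Cartan (coroot i)) else Zero)
    \<in> km_relations I A hs \<alpha> coroot"
| serre_E: "i \<in> I \<Longrightarrow> j \<in> I \<Longrightarrow> i \<noteq> j \<Longrightarrow>
    ((Bracket (Gen (E i)) ^^ nat (1 - A i j)) (Gen (E j)), Zero) \<in> km_relations I A hs \<alpha> coroot"
| serre_F: "i \<in> I \<Longrightarrow> j \<in> I \<Longrightarrow> i \<noteq> j \<Longrightarrow>
    ((Bracket (Gen (F i)) ^^ nat (1 - A i j)) (Gen (F j)), Zero) \<in> km_relations I A hs \<alpha> coroot"

locale kac_moody_algebra =
  cartan_realization I A hs \<alpha> coroot +
  G: presented_lie_algebra gs br "km_generators I" "km_relations I A hs \<alpha> coroot" gen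
  for I :: "'i set" and A :: "'i \<Rightarrow> 'i \<Rightarrow> int"
    and hs :: "complex \<Rightarrow> 'h::ab_group_add \<Rightarrow> 'h"
    and \<alpha> :: "'i \<Rightarrow> 'h \<Rightarrow> complex" and coroot :: "'i \<Rightarrow> 'h"
    and gs :: "complex \<Rightarrow> 'g::ab_group_add \<Rightarrow> 'g" and br :: "'g \<Rightarrow> 'g \<Rightarrow> 'g"
    and gen :: "('h, 'i) km_gen \<Rightarrow> 'g"

definition weight_le :: "'i set \<Rightarrow> ('i \<Rightarrow> 'h \<Rightarrow> complex) \<Rightarrow> ('h \<Rightarrow> complex) \<Rightarrow> ('h \<Rightarrow> complex) \<Rightarrow> bool"
  where "weight_le I \<alpha> \<mu> \<Lambda> \<longleftrightarrow>
    (\<exists>n :: 'i \<Rightarrow> nat. \<Lambda> - \<mu> = (\<Sum>i\<in>I. cfun_scale (of_nat (n i)) (\<alpha> i)))"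

locale lie_module = G: lie_algebra gs br + V: vector_space vs
  for gs :: "complex \<Rightarrow> 'g::ab_group_add \<Rightarrow> 'g" and br :: "'g \<Rightarrow> 'g \<Rightarrow> 'g"
    and vs :: "complex \<Rightarrow> 'v::ab_group_add \<Rightarrow> 'v" +
  fixes act :: "'g \<Rightarrow> 'v \<Rightarrow> 'v"
  assumes act_linear: "Vector_Spaces.linear vs vs (act x)"
    and act_linear_left: "Vector_Spaces.linear gs vs (\<lambda>x. act x v)"
    and act_bracket: "act (br x y) v = act x (act y v) - act y (act x v)"

definition submodule ::
  "(complex \<Rightarrow> 'v \<Rightarrow> 'v) \<Rightarrow> ('g \<Rightarrow> 'v \<Rightarrow> 'v) \<Rightarrow> 'v::ab_group_add set \<Rightarrow> bool"
  where "submodule vs act W \<longleftrightarrow> module.subspace vs W \<and> (\<forall>x. \<forall>w\<in>W. act x w \<in> W)"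

definition simple_module ::
  "(complex \<Rightarrow> 'v \<Rightarrow> 'v) \<Rightarrow> ('g \<Rightarrow> 'v \<Rightarrow> 'v::ab_group_add) \<Rightarrow> bool"
  where "simple_module vs act \<longleftrightarrow>
    (UNIV :: 'v set) \<noteq> {0} \<and> (\<forall>W. submodule vs act W \<longrightarrow> W = {0} \<or> W = UNIV)"

definition weight_space ::
  "(('h, 'i) km_gen \<Rightarrow> 'g) \<Rightarrow> (complex \<Rightarrow> 'v \<Rightarrow> 'v) \<Rightarrow> ('g \<Rightarrow> 'v \<Rightarrow> 'v) \<Rightarrow> ('h \<Rightarrow> complex) \<Rightarrow> 'v set"
  where "weight_space gen vs act \<mu> = {v. \<forall>h. act (gen (Cartan h)) v = vs (\<mu> h) v}"

definition wt ::
  "(complex \<Rightarrow> 'h \<Rightarrow> 'h) \<Rightarrow> (('h, 'i) km_gen \<Rightarrow> 'g) \<Rightarrow> (complex \<Rightarrow> 'v \<Rightarrow> 'v) \<Rightarrow> ('g \<Rightarrow> 'v \<Rightarrow> 'v::ab_group_add) \<Rightarrow>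
    ('h::ab_group_add \<Rightarrow> complex) set"
  where "wt hs gen vs act = {\<mu> \<in> dual hs. weight_space gen vs act \<mu> \<noteq> {0}}"

text \<open>A module that is both \<open>simple_module\<close> and \<open>highest_weight_module\<close> with weight \<open>\<Lambda>\<close> is
  a copy of \<open>L(\<Lambda>)\<close>, which is unique up to isomorphism. That \<open>v\<close> generates the module is the
  statement that no proper submodule contains \<open>v\<close>.\<close>

definition highest_weight_module ::
  "'i set \<Rightarrow> (('h, 'i) km_gen \<Rightarrow> 'g) \<Rightarrow> (complex \<Rightarrow> 'v \<Rightarrow> 'v) \<Rightarrow> ('g \<Rightarrow> 'v \<Rightarrow> 'v::ab_group_add) \<Rightarrow>
    ('h \<Rightarrow> complex) \<Rightarrow> bool"
  where "highest_weight_module I gen vs act \<Lambda> \<longleftrightarrow>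
    (\<exists>v. v \<noteq> 0 \<and> v \<in> weight_space gen vs act \<Lambda> \<and> (\<forall>i\<in>I. act (gen (E i)) v = 0) \<and>
      (\<forall>W. submodule vs act W \<and> v \<in> W \<longrightarrow> W = UNIV))"

end

theory Submission
  imports Defs
begin

text \<open>Write a weight of \<open>L(\<Lambda>)\<close> as \<open>\<Lambda> - \<Sum> n\<^sub>i \<alpha>\<^sub>i\<close>, let \<open>N\<close> be the set of the coefficient vectors \<open>n\<close>, and
  let \<open>J\<close> be the set of \<open>i\<close> for which \<open>\<langle>coroot i, \<Lambda>\<rangle>\<close> is a natural number. For \<open>i \<in> J\<close> the
  operator \<open>f\<^sub>i\<close> is locally nilpotent, so \<open>sl\<^sub>2\<close> theory gives invariance of the weights under the
  reflection \<open>s\<^sub>i\<close> and unbroken strings; for \<open>i \<notin> J\<close> it is injective, so the weights are closed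
  under subtraction of \<open>\<alpha>\<^sub>i\<close>.

  The rest is combinatorics. Reflections reduce to a \<open>J\<close>-dominant point \<open>n\<close> of the hull. Take a
  maximal \<open>k \<le> n\<close> in \<open>N\<close> and suppose that \<open>T = {i. k\<^sub>i < n\<^sub>i}\<close> is nonempty. Then \<open>T \<subseteq> J\<close>, and the
  weight of \<open>k\<close> is nonpositive on the coroots of \<open>T\<close>. Choose \<open>s\<close> maximal with
  \<open>w = k - s (n - k) \<ge> 0\<close> on \<open>T\<close>. Comparing signs in the rows of \<open>A\<close> where \<open>w\<close> vanishes shows that
  these rows form a union of components of the support of \<open>n\<close> on which \<open>\<Lambda>\<close> vanishes. No weight
  supported in the support of \<open>n\<close> can involve such a component, which contradicts membership of
  \<open>n\<close> in the hull.\<close>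

section \<open>Saturation of coefficient sets\<close>

text \<open>The axioms from \<open>zero_mem\<close> on record what representation theory supplies
  about the weights; \<open>b i\<close> matters for \<open>i\<close> in \<open>J\<close>
  only.\<close>

locale coefficient_set =
  fixes I J :: "'i set" and A :: "'i \<Rightarrow> 'i \<Rightarrow> int" and b :: "'i \<Rightarrow> int" and N :: "('i \<Rightarrow> nat) set"
  assumes finite_I: "finite I"
    and diag: "i \<in> I \<Longrightarrow> A i i = 2"
    and off_diag: "i \<in> I \<Longrightarrow> j \<in> I \<Longrightarrow> i \<noteq> j \<Longrightarrow> A i j \<le> 0"
    and J_subset: "J \<subseteq> I"
    and b_nonneg: "i \<in> J \<Longrightarrow> b i \<ge> 0"
    and zero_mem: "(\<lambda>_. 0) \<in> N"
    and support: "n \<in> N \<Longrightarrow> i \<notin> I \<Longrightarrow> n i = 0"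
    and descent: "n \<in> N \<Longrightarrow> n \<noteq> (\<lambda>_. 0) \<Longrightarrow> \<exists>i\<in>I. \<exists>m\<in>N. n = m(i := Suc (m i))"
    and free_step: "n \<in> N \<Longrightarrow> i \<in> I - J \<Longrightarrow> n(i := Suc (n i)) \<in> N"
    and string_step: "n \<in> N \<Longrightarrow> i \<in> J \<Longrightarrow> b i - (\<Sum>j\<in>I. A i j * int (n j)) > 0 \<Longrightarrow>
      n(i := Suc (n i)) \<in> N"
    and reflection: "n \<in> N \<Longrightarrow> i \<in> J \<Longrightarrow>
      \<exists>k. int k = int (n i) + (b i - (\<Sum>j\<in>I. A i j * int (n j))) \<and> n(i := k) \<in> N"
begin

text \<open>For \<open>i\<close> in \<open>J\<close> this is the value of the weight with
  coefficient vector \<open>n\<close> on the coroot of \<open>i\<close>.\<close>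

definition pairing :: "('i \<Rightarrow> nat) \<Rightarrow> 'i \<Rightarrow> int"
  where "pairing n i = b i - (\<Sum>j\<in>I. A i j * int (n j))"

lemma of_int_pairing:
  "real_of_int (pairing n i) = real_of_int (b i) - (\<Sum>j\<in>I. real_of_int (A i j) * real (n j))"
  by (simp add: pairing_def)

section \<open>The hull of the coefficient set: reflections and faces\<close>

definition hull_N :: "('i \<Rightarrow> real) set"
  where "hull_N = convex hull ((\<lambda>n i. real (n i)) ` N)"

lemma hull_N_subset:
  assumes "convex C" and "\<And>n. n \<in> N \<Longrightarrow> (\<lambda>i. real (n i)) \<in> C"
  shows "hull_N \<subseteq> C"
  unfolding hull_N_def using assms by (intro hull_minimal) auto

lemma hull_N_nonneg: "x \<in> hull_N \<Longrightarrow> 0 \<le> x i"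
proof -
  have "hull_N \<subseteq> {x. 0 \<le> x i}"
    by (rule hull_N_subset) (auto simp: convex_def scaleR_fun_def)
  then show "x \<in> hull_N \<Longrightarrow> 0 \<le> x i" by auto
qed

lemma hull_N_support: "x \<in> hull_N \<Longrightarrow> i \<notin> I \<Longrightarrow> x i = 0"
proof -
  assume i: "i \<notin> I"
  have "hull_N \<subseteq> {x. x i = 0}"
    by (rule hull_N_subset) (auto simp: convex_def scaleR_fun_def support i)
  then show "x \<in> hull_N \<Longrightarrow> x i = 0" by auto
qed

text \<open>The reflection is an affine map taking \<open>N\<close> into \<open>N\<close>, so the
  preimage of the hull under it is convex and contains \<open>N\<close>.\<close>

lemma hull_N_reflection:
  assumes i: "i \<in> J" and x: "x \<in> hull_N"
  shows "x(i := x i + (real_of_int (b i) - (\<Sum>j\<in>I. real_of_int (A i j) * x j))) \<in> hull_N"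
proof -
  define s :: "('i \<Rightarrow> real) \<Rightarrow> 'i \<Rightarrow> real" where
    "s = (\<lambda>x. x(i := x i + (real_of_int (b i) - (\<Sum>j\<in>I. real_of_int (A i j) * x j))))"
  have affine: "s (u *\<^sub>R x + v *\<^sub>R y) = u *\<^sub>R s x + v *\<^sub>R s y" if uv: "u + v = 1" for u v x y
  proof
    fix j
    have *: "real_of_int (b i) = u * real_of_int (b i) + v * real_of_int (b i)"
      using uv by (metis distrib_right mult_1)
    have "(\<Sum>j\<in>I. real_of_int (A i j) * (u * x j + v * y j))
        = u * (\<Sum>j\<in>I. real_of_int (A i j) * x j) + v * (\<Sum>j\<in>I. real_of_int (A i j) * y j)"
      by (simp add: algebra_simps sum.distrib sum_distrib_left)
    then show "s (u *\<^sub>R x + v *\<^sub>R y) j = (u *\<^sub>R s x + v *\<^sub>R s y) j"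
      unfolding s_def by (subst *) (simp add: scaleR_fun_def algebra_simps)
  qed
  have "hull_N \<subseteq> {x. s x \<in> hull_N}"
  proof (rule hull_N_subset)
    show "convex {x. s x \<in> hull_N}"
      unfolding convex_def using affine convex_convex_hull[of "(\<lambda>n i. real (n i)) ` N"]
      by (auto simp: hull_N_def convex_def)
  next
    fix n assume n: "n \<in> N"
    from reflection[OF n i] obtain k
      where k: "int k = int (n i) + (b i - (\<Sum>j\<in>I. A i j * int (n j)))" "n(i := k) \<in> N"
      by blast
    have "real k = real_of_int (int k)" by simp
    then have "real k = real (n i) + (real_of_int (b i) - (\<Sum>j\<in>I. real_of_int (A i j) * real (n j)))"
      unfolding k(1) by simp
    then have "s (\<lambda>i. real (n i)) = (\<lambda>j. real ((n(i := k)) j))"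
      unfolding s_def by auto
    then show "(\<lambda>i. real (n i)) \<in> {x. s x \<in> hull_N}"
      using k(2) unfolding hull_N_def by (auto intro!: hull_inc simp del: fun_upd_apply)
  qed
  then show ?thesis using x unfolding s_def by auto
qed

text \<open>Among nonnegative vectors, those vanishing wherever \<open>n\<close> does form a face.
  If the claim failed, \<open>N\<close> would lie in the convex set \<open>?C\<close>, whose points
  leave that face or vanish at \<open>r\<close>; \<open>n\<close> does neither.\<close>

lemma hull_N_face:
  assumes n: "(\<lambda>i. real (n i)) \<in> hull_N" and r: "n r > 0"
  shows "\<exists>m\<in>N. m r > 0 \<and> (\<forall>i. n i = 0 \<longrightarrow> m i = 0)"
proof (rule ccontr)
  assume contra: "\<not> ?thesis"
  let ?C = "{x. (\<forall>i. 0 \<le> x i) \<and> ((\<exists>i. n i = 0 \<and> x i > 0) \<or> x r = 0)} :: ('i \<Rightarrow> real) set"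
  have "hull_N \<subseteq> ?C"
  proof (rule hull_N_subset)
    show "convex ?C"
    proof (rule convexI)
      fix x y :: "'i \<Rightarrow> real" and u v :: real
      assume x: "x \<in> ?C" and y: "y \<in> ?C" and uv: "0 \<le> u" "0 \<le> v" "u + v = 1"
      have nonneg: "0 \<le> (u *\<^sub>R x + v *\<^sub>R y) i" for i
        using x y uv by (simp add: scaleR_fun_def)
      \<comment> \<open>A positive coordinate survives only with a positive coefficient, so the
        endpoints are treated apart.\<close>
      consider "u = 0" | "v = 0" | "u > 0" "v > 0" using uv by linarith
      then show "u *\<^sub>R x + v *\<^sub>R y \<in> ?C"
      proof cases
        case 3
        have "(\<exists>i. n i = 0 \<and> (u *\<^sub>R x + v *\<^sub>R y) i > 0) \<or> (u *\<^sub>R x + v *\<^sub>R y) r = 0"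
        proof (cases "x r = 0 \<and> y r = 0")
          case False
          then obtain i where "n i = 0" "x i > 0 \<or> y i > 0" using x y by auto
          moreover have "x i \<ge> 0" "y i \<ge> 0" using x y by auto
          ultimately have "u * x i + v * y i > 0"
            using 3 by (auto intro: add_pos_nonneg add_nonneg_pos)
          then show ?thesis using \<open>n i = 0\<close> by (auto simp: scaleR_fun_def)
        qed (simp add: scaleR_fun_def)
        then show ?thesis using nonneg by blast
      qed (use x y uv in auto)
    qed
  next
    fix m assume "m \<in> N"
    then show "(\<lambda>i. real (m i)) \<in> ?C" using contra by auto
  qed
  then have "(\<lambda>i. real (n i)) \<in> ?C" using n by blast
  then show False using r by auto
qed

text \<open>Some vector of \<open>N\<close> meets \<open>R\<close> and vanishes wherever
  \<open>n\<close> does. A smallest one, \<open>m\<close>, arises by \<open>descent\<close> from a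
  \<open>p\<close> that misses \<open>R\<close>, in a step at some \<open>i\<close> of
  \<open>R\<close>. Row \<open>i\<close> vanishes on \<open>p\<close>, so reflecting
  \<open>m\<close> would turn its coordinate 1 into -1.\<close>

lemma no_isolated_zero_set:
  assumes hull: "(\<lambda>i. real (n i)) \<in> hull_N"
    and R: "R \<subseteq> J" "r \<in> R" "n r > 0"
    and b0: "\<And>i. i \<in> R \<Longrightarrow> b i = 0"
    and isolated: "\<And>i j. i \<in> R \<Longrightarrow> j \<in> I - R \<Longrightarrow> n j > 0 \<Longrightarrow> A i j = 0"
  shows False
proof -
  define Q where "Q = (\<lambda>m. m \<in> N \<and> (\<exists>r\<in>R. m r > 0) \<and> (\<forall>i. n i = 0 \<longrightarrow> m i = 0))"
  have "\<exists>m. Q m" using hull_N_face[OF hull R(3)] R(2) unfolding Q_def by blast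
  then obtain m where Qm: "Q m" and min: "\<And>m'. Q m' \<Longrightarrow> sum m I \<le> sum m' I"
    using ex_has_least_nat[of Q _ "\<lambda>m. sum m I"] by blast
  have "m \<noteq> (\<lambda>_. 0)" using Qm by (auto simp: Q_def)
  with descent Qm obtain i p where i: "i \<in> I" and p: "p \<in> N" "m = p(i := Suc (p i))"
    unfolding Q_def by blast
  have "sum m I = Suc (sum p I)"
    using i finite_I by (simp add: p(2) sum.remove[of I i])
  then have "\<not> Q p" using min[of p] by auto
  moreover have supp: "n j = 0 \<longrightarrow> p j = 0" for j
    using Qm unfolding Q_def p(2) by (metis fun_upd_apply nat.distinct(1))
  ultimately have p0: "p r = 0" if "r \<in> R" for r using p that unfolding Q_def by auto
  with Qm have iR: "i \<in> R" unfolding Q_def p(2) by (auto split: if_splits)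
  then have iJ: "i \<in> J" using R by auto
  have ni: "(\<Sum>j\<in>I. A i j * int (p j)) = 0"
  proof (rule sum.neutral, intro ballI)
    fix j assume "j \<in> I"
    then show "A i j * int (p j) = 0"
      using p0[of j] supp[of j] isolated[OF iR, of j] by (cases "j \<in> R") auto
  qed
  have "(\<Sum>j\<in>I. A i j * int (m j)) = (\<Sum>j\<in>I. A i j * int (p j) + (if j = i then 2 else 0))"
    by (intro sum.cong refl) (auto simp: p(2) diag algebra_simps)
  also have "\<dots> = 2" using i finite_I ni by (simp add: sum.distrib)
  finally have "\<exists>k. int k = int (m i) - 2"
    using reflection[OF _ iJ, of m] Qm b0[OF iR] unfolding Q_def by fastforce
  moreover have "m i = 1" using p0[OF iR] p(2) by simp
  ultimately show False by auto
qed

section \<open>Dominant points of the hull, then arbitrary ones\<close>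

lemma dominant_mem:
  assumes hull: "(\<lambda>i. real (n i)) \<in> hull_N"
    and dominant: "\<And>i. i \<in> J \<Longrightarrow> pairing n i \<ge> 0"
  shows "n \<in> N"
proof -
  have supp_n: "n i = 0" if "i \<notin> I" for i using hull_N_support[OF hull that] by simp
  define Q where "Q = (\<lambda>k. k \<in> N \<and> (\<forall>i. k i \<le> n i))"
  have "Q (\<lambda>_. 0)" using zero_mem by (simp add: Q_def)
  moreover have "sum k I \<le> sum n I" if "Q k" for k
    using that by (auto simp: Q_def intro: sum_mono)
  ultimately have "\<exists>k. Q k \<and> (\<forall>k'. Q k' \<longrightarrow> sum k' I \<le> sum k I)"
    by (intro ex_has_greatest_nat[of Q "\<lambda>_. 0" "\<lambda>k. sum k I" "Suc (sum n I)"])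
      (auto simp: less_Suc_eq_le)
  then obtain k where Qk: "Q k" and max: "\<And>k'. Q k' \<Longrightarrow> sum k' I \<le> sum k I" by blast
  have kN: "k \<in> N" and kn: "\<And>i. k i \<le> n i" using Qk by (auto simp: Q_def)
  define T where "T = {i \<in> I. k i < n i}"
  have finT: "finite T" and TI: "T \<subseteq> I" using finite_I by (auto simp: T_def)
  have off_T: "k i = n i" if "i \<notin> T" for i
    using that kn[of i] supp_n[of i] unfolding T_def by (cases "i \<in> I") auto
  have maximal: "k(i := Suc (k i)) \<notin> N" if "i \<in> T" for i
  proof
    assume "k(i := Suc (k i)) \<in> N"
    then have "Q (k(i := Suc (k i)))" using that kn by (auto simp: Q_def T_def)
    from max[OF this] show False
      using that TI finite_I by (simp add: sum.remove[of I i] subset_iff)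
  qed
  \<comment> \<open>Outside \<open>J\<close> a free step would enlarge \<open>k\<close>, and inside
    \<open>J\<close> a positive pairing would.\<close>
  have TJ: "T \<subseteq> J" using maximal free_step[OF kN] TI by blast
  have pk: "pairing k i \<le> 0" if "i \<in> T" for i
    using string_step[OF kN, of i] maximal[OF that] that TJ unfolding pairing_def by force
  have "T = {}"
  proof (rule ccontr)
    assume ne: "T \<noteq> {}"
    define d where "d = (\<lambda>j. real (n j) - real (k j))"
    have d_pos: "d j > 0" if "j \<in> T" for j using that by (auto simp: d_def T_def)
    \<comment> \<open>On \<open>T\<close>, \<open>w j\<close> is nonnegative iff \<open>s\<close> is
      at most \<open>k j / d j\<close>. The minimum is thus the largest admissible \<open>s\<close>,
      and an index attaining it makes \<open>R\<close> nonempty.\<close>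
    define s where "s = Min ((\<lambda>j. real (k j) / d j) ` T)"
    define w where "w = (\<lambda>j. real (k j) - s * d j)"
    define R where "R = {i \<in> T. w i = 0}"
    have s_le: "s \<le> real (k j) / d j" if "j \<in> T" for j
      using finT that unfolding s_def by (intro Min_le) auto
    have "s \<in> (\<lambda>j. real (k j) / d j) ` T"
      unfolding s_def using finT ne by (intro Min_in) auto
    then obtain r where r: "r \<in> T" "s = real (k r) / d r" by auto
    then have rR: "r \<in> R" using d_pos[of r] by (auto simp: R_def w_def)
    have s0: "s \<ge> 0" using r d_pos[of r] by simp
    have w0: "w j \<ge> 0" if "j \<in> T" for j
      using s_le[OF that] d_pos[OF that] by (simp add: w_def field_simps)
    \<comment> \<open>Row \<open>i\<close> on \<open>k\<close> splits into the row on
      \<open>w\<close> over \<open>T\<close>, \<open>s\<close> times the row on \<open>d\<close>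
      over \<open>T\<close>, and the row on \<open>n\<close> outside \<open>T\<close>. All three are
      nonpositive, yet their sum is at least \<open>b i\<close>, which is nonnegative. So
      \<open>b i\<close> and all three vanish, and the first and third vanish term by term.\<close>
    have main: "b i = 0 \<and> (\<forall>j\<in>T. real_of_int (A i j) * w j = 0) \<and>
        (\<forall>j\<in>I-T. real_of_int (A i j) * real (n j) = 0)" if iR: "i \<in> R" for i
    proof -
      have iT: "i \<in> T" and wi: "w i = 0" using iR by (auto simp: R_def)
      have iI: "i \<in> I" and iJ: "i \<in> J" using iT TI TJ by auto
      have split: "(\<Sum>j\<in>I. real_of_int (A i j) * g j) =
          (\<Sum>j\<in>I-T. real_of_int (A i j) * g j) + (\<Sum>j\<in>T. real_of_int (A i j) * g j)" for g
        using finite_I TI by (rule sum.subset_diff[rotated])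
      have pk': "real_of_int (b i) - (\<Sum>j\<in>I. real_of_int (A i j) * real (k j)) \<le> 0"
        using pk[OF iT] of_int_pairing[of k i] by linarith
      have pn': "real_of_int (b i) - (\<Sum>j\<in>I. real_of_int (A i j) * real (n j)) \<ge> 0"
        using dominant[OF iJ] of_int_pairing[of n i] by linarith
      have "(\<Sum>j\<in>I. real_of_int (A i j) * d j) =
          (\<Sum>j\<in>I. real_of_int (A i j) * real (n j)) - (\<Sum>j\<in>I. real_of_int (A i j) * real (k j))"
        by (simp add: d_def algebra_simps sum_subtractf)
      moreover have "(\<Sum>j\<in>I-T. real_of_int (A i j) * d j) = 0"
        by (rule sum.neutral) (auto simp: d_def off_T)
      ultimately have dT: "(\<Sum>j\<in>T. real_of_int (A i j) * d j) \<le> 0"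
        using pk' pn' split[of d] by linarith
      have wT: "real_of_int (A i j) * w j \<le> 0" if "j \<in> T" for j
        using that wi w0[OF that] off_diag[OF iI, of j] TI
        by (cases "j = i") (auto intro!: mult_nonpos_nonneg)
      have nT: "real_of_int (A i j) * real (n j) \<le> 0" if "j \<in> I - T" for j
        using that off_diag[OF iI, of j] iT by (intro mult_nonpos_nonneg) auto
      have "(\<Sum>j\<in>T. real_of_int (A i j) * real (k j)) =
          (\<Sum>j\<in>T. real_of_int (A i j) * w j) + s * (\<Sum>j\<in>T. real_of_int (A i j) * d j)"
        by (simp add: w_def algebra_simps sum.distrib sum_subtractf sum_distrib_left)
      moreover have "(\<Sum>j\<in>I-T. real_of_int (A i j) * real (k j)) =
          (\<Sum>j\<in>I-T. real_of_int (A i j) * real (n j))"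
        by (intro sum.cong) (auto simp: off_T)
      moreover have "s * (\<Sum>j\<in>T. real_of_int (A i j) * d j) \<le> 0"
        using s0 dT by (simp add: mult_nonneg_nonpos)
      moreover have sw: "(\<Sum>j\<in>T. real_of_int (A i j) * w j) \<le> 0"
        using wT by (rule sum_nonpos)
      moreover have sn: "(\<Sum>j\<in>I-T. real_of_int (A i j) * real (n j)) \<le> 0"
        using nT by (rule sum_nonpos)
      moreover have "b i \<ge> 0" using b_nonneg[OF iJ] .
      ultimately have "real_of_int (b i) = 0" "(\<Sum>j\<in>T. real_of_int (A i j) * w j) = 0"
          "(\<Sum>j\<in>I-T. real_of_int (A i j) * real (n j)) = 0"
        using pk' split[of "\<lambda>j. real (k j)"] by linarith+
      then show ?thesis
        using sum_nonneg_eq_0_iff[of T "\<lambda>j. - (real_of_int (A i j) * w j)"]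
          sum_nonneg_eq_0_iff[of "I - T" "\<lambda>j. - (real_of_int (A i j) * real (n j))"]
          wT nT finT finite_I by (simp add: sum_negf)
    qed
    show False
    proof (rule no_isolated_zero_set[OF hull _ rR])
      show "R \<subseteq> J" using TJ by (auto simp: R_def)
      show "n r > 0" using r by (auto simp: T_def)
      show "b i = 0" if "i \<in> R" for i using main[OF that] by blast
      show "A i j = 0" if "i \<in> R" "j \<in> I - R" "n j > 0" for i j
      proof (cases "j \<in> T")
        case True
        then have "w j \<noteq> 0" using that by (auto simp: R_def)
        then show ?thesis using main[OF that(1)] True by auto
      next
        case False
        then show ?thesis using main[OF that(1)] that by auto
      qed
    qed
  qed
  then have "k = n" using off_T by auto
  then show ?thesis using kN by simp
qed

text \<open>Where the pairing is negative, reflection lowers a coordinate and stays in the hull. The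
  induction hypothesis puts the reflected vector in \<open>N\<close>, and reflecting back recovers
  \<open>n\<close>.\<close>

theorem hull_N_mem: "(\<lambda>i. real (n i)) \<in> hull_N \<Longrightarrow> n \<in> N"
proof (induction "sum n I" arbitrary: n rule: less_induct)
  case less
  show ?case
  proof (cases "\<forall>i\<in>J. pairing n i \<ge> 0")
    case True
    then show ?thesis using dominant_mem[OF less.prems] by blast
  next
    case False
    then obtain i where i: "i \<in> J" "pairing n i < 0" by force
    define z where "z = int (n i) + pairing n i"
    have z: "real_of_int z = real (n i) +
        (real_of_int (b i) - (\<Sum>j\<in>I. real_of_int (A i j) * real (n j)))"
      by (simp add: z_def pairing_def)
    note refl = hull_N_reflection[OF i(1) less.prems, folded z]
    have "z \<ge> 0" using hull_N_nonneg[OF refl, of i] by simp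
    then have eq: "(\<lambda>j. real (n j))(i := real_of_int z) = (\<lambda>j. real ((n(i := nat z)) j))"
      by auto
    have less_n: "nat z < n i" using i(2) \<open>z \<ge> 0\<close> by (simp add: z_def)
    have iI: "i \<in> I" using i(1) J_subset by auto
    have "sum (n(i := nat z)) I < sum n I"
      using iI finite_I less_n by (simp add: sum.remove[of I i])
    then have m: "n(i := nat z) \<in> N" using less.hyps refl unfolding eq by blast
    obtain k where k: "int k = int (nat z) +
        (b i - (\<Sum>j\<in>I. A i j * int ((n(i := nat z)) j)))" "n(i := k) \<in> N"
      using reflection[OF m i(1)] by auto
    \<comment> \<open>The new coordinate shifts row \<open>i\<close> by \<open>A i i = 2\<close>
      times the pairing, so the pairing changes sign.\<close>
    have "(\<Sum>j\<in>I. A i j * int ((n(i := nat z)) j)) =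
        (\<Sum>j\<in>I. A i j * int (n j) + (if j = i then 2 * pairing n i else 0))"
      using \<open>z \<ge> 0\<close> by (intro sum.cong refl) (auto simp: diag iI z_def algebra_simps)
    also have "\<dots> = b i + pairing n i"
      using iI finite_I by (simp add: sum.distrib pairing_def)
    finally have "int k = int (n i)" using k(1) \<open>z \<ge> 0\<close> by (simp add: z_def)
    then show ?thesis using k(2) by simp
  qed
qed

end

section \<open>Modules over Kac--Moody algebras\<close>

lemma vector_space_cfun_scale: "vector_space cfun_scale"
  by unfold_locales (auto simp: cfun_scale_def fun_eq_iff algebra_simps)

locale km_module = kac_moody_algebra I A hs \<alpha> coroot gs br gen + M: lie_module gs br vs act
  for I :: "'i set" and A :: "'i \<Rightarrow> 'i \<Rightarrow> int"
    and hs :: "complex \<Rightarrow> 'h::ab_group_add \<Rightarrow> 'h"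
    and \<alpha> :: "'i \<Rightarrow> 'h \<Rightarrow> complex" and coroot :: "'i \<Rightarrow> 'h"
    and gs :: "complex \<Rightarrow> 'g::ab_group_add \<Rightarrow> 'g" and br :: "'g \<Rightarrow> 'g \<Rightarrow> 'g"
    and gen :: "('h, 'i) km_gen \<Rightarrow> 'g"
    and vs :: "complex \<Rightarrow> 'v::ab_group_add \<Rightarrow> 'v" and act :: "'g \<Rightarrow> 'v \<Rightarrow> 'v"
begin

section \<open>The generators and their action\<close>

abbreviation H :: "'h \<Rightarrow> 'v \<Rightarrow> 'v" where "H h \<equiv> act (gen (Cartan h))"
abbreviation e :: "'i \<Rightarrow> 'v \<Rightarrow> 'v" where "e i \<equiv> act (gen (E i))"
abbreviation f :: "'i \<Rightarrow> 'v \<Rightarrow> 'v" where "f i \<equiv> act (gen (F i))"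
abbreviation Wt :: "('h \<Rightarrow> complex) \<Rightarrow> 'v set" where "Wt \<equiv> weight_space gen vs act"

lemma act_hom: "module_hom vs vs (act x)"
  using M.act_linear by (simp add: module_hom_iff_linear)

lemma act_hom_left: "module_hom gs vs (\<lambda>x. act x v)"
  using M.act_linear_left by (simp add: module_hom_iff_linear)

lemmas act_add = module_hom.add[OF act_hom]
  and act_scale = module_hom.scale[OF act_hom]
  and act_zero [simp] = module_hom.zero[OF act_hom]
  and act_diff = module_hom.diff[OF act_hom]
  and act_add_left = module_hom.add[OF act_hom_left]
  and act_scale_left = module_hom.scale[OF act_hom_left]
  and act_zero_left [simp] = module_hom.zero[OF act_hom_left]

lemma relation:
  assumes "(s, t) \<in> km_relations I A hs \<alpha> coroot"
    and "set_lie_term s \<subseteq> km_generators I" "set_lie_term t \<subseteq> km_generators I"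
  shows "lie_eval gs br gen s = lie_eval gs br gen t"
  using G.eval_eq_iff[OF assms(2,3)] lie_cong.rel[OF assms(1)] by simp

lemma gen_cartan_E: "i \<in> I \<Longrightarrow> br (gen (Cartan h)) (gen (E i)) = gs (\<alpha> i h) (gen (E i))"
  using relation[OF km_relations.cartan_E] by (simp add: km_generators_def)

lemma gen_cartan_F: "i \<in> I \<Longrightarrow> br (gen (Cartan h)) (gen (F i)) = gs (- \<alpha> i h) (gen (F i))"
  using relation[OF km_relations.cartan_F] by (simp add: km_generators_def)

lemma gen_E_F: "i \<in> I \<Longrightarrow> j \<in> I \<Longrightarrow>
    br (gen (E i)) (gen (F j)) = (if i = j then gen (Cartan (coroot i)) else 0)"
  using relation[OF km_relations.E_F, of i j] by (auto simp: km_generators_def split: if_splits)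

lemma lie_eval_iterated_bracket:
  "lie_eval gs br gen ((Bracket (Gen x) ^^ n) (Gen y)) = (br (gen x) ^^ n) (gen y)"
  by (induction n) auto

lemma set_iterated_bracket: "set_lie_term ((Bracket (Gen x) ^^ n) (Gen y)) \<subseteq> {x, y}"
  by (induction n) auto

lemma gen_serre_F: "i \<in> I \<Longrightarrow> j \<in> I \<Longrightarrow> i \<noteq> j \<Longrightarrow> (br (gen (F i)) ^^ nat (1 - A i j)) (gen (F j)) = 0"
  using relation[OF km_relations.serre_F, of i j] set_iterated_bracket[where x = "F i" and y = "F j" and n = "nat (1 - A i j)"]
  unfolding lie_eval_iterated_bracket by (force simp: km_generators_def)

lemma br_hom: "module_hom gs gs (br x)" "module_hom gs gs (\<lambda>x. br x y)"
  using G.bracket_linear_right G.bracket_linear_left by (simp_all add: module_hom_iff_linear)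

lemmas br_zero_right [simp] = module_hom.zero[OF br_hom(1)]
  and br_neg_right = module_hom.neg[OF br_hom(1)]
  and br_scale_right = module_hom.scale[OF br_hom(1)]

lemma br_swap: "br y x = - br x y"
proof -
  have add: "br (x + y) z = br x z + br y z" "br z (x + y) = br z x + br z y" for z
    using module_hom.add[OF br_hom(1)] module_hom.add[OF br_hom(2)] by blast+
  have "br (x + y) (x + y) = br y x + br x y"
    unfolding add by (simp add: G.bracket_self)
  then show ?thesis by (simp add: eq_neg_iff_add_eq_0 G.bracket_self)
qed

lemma H_e: "i \<in> I \<Longrightarrow> H h (e i x) = e i (H h x) + vs (\<alpha> i h) (e i x)"
  using M.act_bracket[of "gen (Cartan h)" "gen (E i)" x]
  by (simp add: gen_cartan_E act_scale_left algebra_simps)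

lemma H_f: "i \<in> I \<Longrightarrow> H h (f i x) = f i (H h x) - vs (\<alpha> i h) (f i x)"
  using M.act_bracket[of "gen (Cartan h)" "gen (F i)" x]
  by (simp add: gen_cartan_F act_scale_left algebra_simps del: G.scale_minus_left)

lemma e_f: "i \<in> I \<Longrightarrow> j \<in> I \<Longrightarrow> e i (f j x) = f j (e i x) + (if i = j then H (coroot i) x else 0)"
  using M.act_bracket[of "gen (E i)" "gen (F j)" x]
  by (auto simp add: gen_E_F algebra_simps split: if_splits)

text \<open>Every element of the Lie algebra is the value of a Lie word in the generators, and a
  bracket acts as a commutator, so stability passes from generators to words.\<close>

lemma submoduleI:
  assumes W: "M.V.subspace W"
    and "\<And>h w. w \<in> W \<Longrightarrow> H h w \<in> W"
    and "\<And>i w. i \<in> I \<Longrightarrow> w \<in> W \<Longrightarrow> e i w \<in> W"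
    and "\<And>i w. i \<in> I \<Longrightarrow> w \<in> W \<Longrightarrow> f i w \<in> W"
  shows "submodule vs act W"
proof -
  have gens: "act (gen y) w \<in> W" if "y \<in> km_generators I" "w \<in> W" for y w
    using that assms unfolding km_generators_def by auto
  have "act (lie_eval gs br gen t) w \<in> W"
    if "set_lie_term t \<subseteq> km_generators I" "w \<in> W" for t w
    using that
    by (induction t arbitrary: w)
      (auto simp: gens act_add_left act_scale_left M.act_bracket M.V.subspace_0[OF W]
        intro: M.V.subspace_add[OF W] M.V.subspace_scale[OF W] M.V.subspace_diff[OF W])
  moreover have "\<exists>t. set_lie_term t \<subseteq> km_generators I \<and> x = lie_eval gs br gen t" for x
    using G.generated by (auto simp: image_iff set_eq_iff)
  ultimately show ?thesis unfolding submodule_def using W by metis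
qed

section \<open>Locally nilpotent vectors\<close>

lemma act_pow_hom: "module_hom vs vs (act z ^^ k)"
proof (induction k)
  case 0
  show ?case unfolding funpow.simps module_hom_iff_linear by (rule M.V.linear_id)
next
  case (Suc k)
  then show ?case unfolding funpow.simps by (rule module_hom_compose[OF _ act_hom])
qed

text \<open>Leibniz: when \<open>m + n\<close> copies of \<open>z\<close> act on \<open>y x\<close>, either \<open>m\<close> of them hit \<open>y\<close> or \<open>n\<close> of them
  hit \<open>x\<close>.\<close>

lemma funpow_act_absorb:
  assumes "(br z ^^ m) y = 0" "(act z ^^ n) x = 0"
  shows "(act z ^^ (m + n)) (act y x) = 0"
  using assms
proof (induction "m + n" arbitrary: m n x y)
  case 0
  then show ?case by simp
next
  case (Suc k)
  note hom = act_pow_hom[where z = z and k = k]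
  have "(act z ^^ (m + n)) (act y x) = (act z ^^ k) (act z (act y x))"
    by (simp add: Suc.hyps(2)[symmetric] funpow_swap1)
  also have "act z (act y x) = act (br z y) x + act y (act z x)"
    by (simp add: M.act_bracket)
  also have "(act z ^^ k) (act (br z y) x + act y (act z x)) =
      (act z ^^ k) (act (br z y) x) + (act z ^^ k) (act y (act z x))"
    by (rule module_hom.add[OF hom])
  also have "(act z ^^ k) (act (br z y) x) = 0"
  proof (cases m)
    case 0
    then show ?thesis using Suc.prems module_hom.zero[OF hom] by simp
  next
    case (Suc m')
    then show ?thesis using Suc.hyps(1)[of m' n "br z y" x] Suc.hyps(2) Suc.prems
      by (simp add: funpow_swap1)
  qed
  also have "(act z ^^ k) (act y (act z x)) = 0"
  proof (cases n)
    case 0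
    then show ?thesis using Suc.prems module_hom.zero[OF hom] by simp
  next
    case (Suc n')
    then show ?thesis using Suc.hyps(1)[of m n' y "act z x"] Suc.hyps(2) Suc.prems
      by (simp add: funpow_swap1)
  qed
  finally show ?case by simp
qed

lemma act_pow_eq_0_mono:
  assumes "(act z ^^ m) x = 0" "m \<le> n"
  shows "(act z ^^ n) x = 0"
proof -
  have "(act z ^^ n) x = (act z ^^ (n - m)) ((act z ^^ m) x)"
    using assms(2) by (metis add.commute comp_apply funpow_add le_add_diff_inverse)
  then show ?thesis using assms(1) module_hom.zero[OF act_pow_hom] by simp
qed

text \<open>By \<open>funpow_act_absorb\<close> it suffices that each generator is killed by some
  power of the bracket with \<open>F i\<close>. For \<open>F j\<close> with \<open>j\<close> other
  than \<open>i\<close> this is a Serre relation.\<close>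

lemma submodule_f_nilpotent:
  assumes i: "i \<in> I"
  shows "submodule vs act {x. \<exists>n. (f i ^^ n) x = 0}" (is "submodule _ _ ?W")
proof -
  have act: "act y w \<in> ?W" if "(br (gen (F i)) ^^ m) y = 0" "w \<in> ?W" for m y w
    using funpow_act_absorb[OF that(1)] that(2) by blast
  show ?thesis
  proof (rule submoduleI)
    show "M.V.subspace ?W"
    proof (rule M.V.subspaceI)
      show "0 \<in> ?W" by (auto intro: exI[of _ 0])
      fix x y c
      assume x: "x \<in> ?W"
      then show "vs c x \<in> ?W" using module_hom.scale[OF act_pow_hom] by auto
      assume "y \<in> ?W"
      with x obtain m n where "(f i ^^ m) x = 0" "(f i ^^ n) y = 0" by auto
      then have "(f i ^^ (max m n)) (x + y) = 0"
        using module_hom.add[OF act_pow_hom] act_pow_eq_0_mono[where z = "gen (F i)"] by simp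
      then show "x + y \<in> ?W" by blast
    qed
  next
    fix h w assume w: "w \<in> ?W"
    have "(br (gen (F i)) ^^ 2) (gen (Cartan h)) = 0"
      by (simp add: numeral_2_eq_2 br_swap[where y = "gen (F i)" and x = "gen (Cartan h)"] gen_cartan_F[OF i]
          br_scale_right G.bracket_self br_neg_right)
    then show "H h w \<in> ?W" using w by (rule act)
  next
    fix j w assume j: "j \<in> I" and w: "w \<in> ?W"
    have FE: "br (gen (F i)) (gen (E j)) = - (if j = i then gen (Cartan (coroot i)) else 0)"
      using i j by (subst br_swap) (simp add: gen_E_F)
    have FH: "br (gen (F i)) (gen (Cartan h)) = gs (\<alpha> i h) (gen (F i))" for h
      by (subst br_swap) (simp add: gen_cartan_F[OF i])
    \<comment> \<open>\<open>E i\<close> goes to minus the coroot, then to a multiple of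
      \<open>F i\<close>, then to 0; hence the exponent 3.\<close>
    have "(br (gen (F i)) ^^ 3) (gen (E j)) = 0"
      by (simp add: numeral_3_eq_3 FE FH br_neg_right br_scale_right G.bracket_self)
    then show "e j w \<in> ?W" using w by (rule act)
    have "\<exists>m. (br (gen (F i)) ^^ m) (gen (F j)) = 0"
    proof (cases "j = i")
      case True
      then show ?thesis by (auto intro!: exI[of _ 1] simp: G.bracket_self)
    next
      case False
      then show ?thesis using gen_serre_F[OF i j] by blast
    qed
    then show "f j w \<in> ?W" using w act by blast
  qed
qed

section \<open>Weight spaces and monomials in the \<open>f i\<close>\<close>

lemma Wt_subspace: "M.V.subspace (Wt \<mu>)"
  by (rule M.V.subspaceI)
    (auto simp: weight_space_def act_add act_scale M.V.scale_right_distrib M.V.scale_left_commute)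

lemma Wt_unique:
  assumes "x \<in> Wt \<mu>" "x \<in> Wt \<nu>" "x \<noteq> 0"
  shows "\<mu> = \<nu>"
  using assms by (auto simp: weight_space_def fun_eq_iff)

lemma e_Wt: "i \<in> I \<Longrightarrow> x \<in> Wt \<mu> \<Longrightarrow> e i x \<in> Wt (\<mu> + \<alpha> i)"
  by (auto simp: weight_space_def H_e act_scale M.V.scale_left_distrib)

lemma f_Wt: "i \<in> I \<Longrightarrow> x \<in> Wt \<mu> \<Longrightarrow> f i x \<in> Wt (\<mu> - \<alpha> i)"
  by (auto simp: weight_space_def H_f act_scale M.V.scale_left_diff_distrib)

text \<open>If \<open>b\<close> has a weight \<nu> other than \<mu>, choose \<open>h\<close>
  separating the two. Then \<open>H h\<close> minus the scalar \<open>\<nu> h\<close> kills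
  \<open>b\<close>, preserves the span of \<open>B\<close> and multiplies \<open>x\<close> by a
  nonzero scalar, so \<open>x\<close> already lies in the span of \<open>B\<close>.\<close>

lemma weight_vector_in_finite_span:
  assumes "finite B" "\<And>b. b \<in> B \<Longrightarrow> \<exists>\<nu>. b \<in> Wt \<nu>"
    and "x \<in> Wt \<mu>" "x \<noteq> 0" "x \<in> M.V.span B"
  shows "\<exists>b\<in>B. b \<noteq> 0 \<and> b \<in> Wt \<mu>"
  using assms
proof (induction B arbitrary: x rule: finite_induct)
  case empty
  then show ?case by simp
next
  case (insert b B)
  obtain \<nu> where \<nu>: "b \<in> Wt \<nu>" using insert.prems by blast
  obtain c where c: "x - vs c b \<in> M.V.span B"
    using insert.prems by (auto simp: M.V.span_breakdown_eq)
  have IH: "y \<in> Wt \<mu> \<Longrightarrow> y \<noteq> 0 \<Longrightarrow> y \<in> M.V.span B \<Longrightarrow> ?case" for y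
    using insert.IH[of y] insert.prems by blast
  show ?case
  proof (cases "\<nu> = \<mu>")
    case True
    show ?thesis
    proof (cases "b = 0")
      case True
      then show ?thesis using c IH[of x] insert.prems by simp
    next
      case False
      then show ?thesis using \<nu> \<open>\<nu> = \<mu>\<close> by auto
    qed
  next
    case False
    then obtain h where h: "\<nu> h \<noteq> \<mu> h" by auto
    let ?T = "\<lambda>y. H h y - vs (\<nu> h) y"
    have "?T y \<in> M.V.span B" if "y \<in> M.V.span B" for y
      using that
    proof (induction rule: M.V.span_induct_alt)
      case base
      then show ?case by (simp add: M.V.span_zero)
    next
      case (step c b' y)
      obtain \<kappa> where "b' \<in> Wt \<kappa>" using insert.prems step by blast
      then have "?T (vs c b' + y) = vs (c * \<kappa> h - \<nu> h * c) b' + ?T y"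
        by (simp add: weight_space_def act_add act_scale algebra_simps
            M.V.scale_left_diff_distrib M.V.scale_right_distrib)
      then show ?case using step by (auto intro: M.V.span_add M.V.span_scale M.V.span_base)
    qed
    from this[OF c] have "vs (\<mu> h - \<nu> h) x \<in> M.V.span B"
      using \<nu> insert.prems
      by (simp add: weight_space_def act_diff act_scale algebra_simps
            M.V.scale_left_diff_distrib M.V.scale_right_diff_distrib)
    from M.V.span_scale[OF this, of "inverse (\<mu> h - \<nu> h)"] have "x \<in> M.V.span B"
      using h by simp
    then show ?thesis using IH insert.prems by blast
  qed
qed

lemma weight_vector_in_span:
  assumes "\<And>b. b \<in> B \<Longrightarrow> \<exists>\<nu>. b \<in> Wt \<nu>"
    and "x \<in> Wt \<mu>" "x \<noteq> 0" "x \<in> M.V.span B"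
  shows "\<exists>b\<in>B. b \<noteq> 0 \<and> b \<in> Wt \<mu>"
proof -
  obtain t r where t: "finite t" "t \<subseteq> B" "x = (\<Sum>a\<in>t. vs (r a) a)"
    using assms(4) unfolding M.V.span_explicit by blast
  then have "x \<in> M.V.span t" by (auto intro: M.V.span_sum M.V.span_scale M.V.span_base)
  then show ?thesis using weight_vector_in_finite_span[OF t(1)] t(2) assms by blast
qed

definition descend :: "('h \<Rightarrow> complex) \<Rightarrow> ('i \<Rightarrow> nat) \<Rightarrow> 'h \<Rightarrow> complex"
  where "descend \<mu> n = \<mu> - (\<Sum>i\<in>I. cfun_scale (of_nat (n i)) (\<alpha> i))"

lemma descend_zero [simp]: "descend \<mu> (\<lambda>_. 0) = \<mu>"
  by (simp add: descend_def cfun_scale_def fun_eq_iff)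

lemma descend_apply: "descend \<mu> n h = \<mu> h - (\<Sum>i\<in>I. of_nat (n i) * \<alpha> i h)"
proof -
  have "(\<Sum>i\<in>S. cfun_scale (of_nat (n i)) (\<alpha> i)) h = (\<Sum>i\<in>S. of_nat (n i) * \<alpha> i h)" for S
    by (induction S rule: infinite_finite_induct) (auto simp: cfun_scale_def)
  then show ?thesis by (simp add: descend_def)
qed

lemma descend_add: "descend (descend \<mu> m) n = descend \<mu> (\<lambda>i. m i + n i)"
  by (simp add: fun_eq_iff descend_apply sum.distrib algebra_simps)

lemma descend_upd:
  assumes "i \<in> I"
  shows "descend \<mu> (n(i := k)) h = descend \<mu> n h - (of_nat k - of_nat (n i)) * \<alpha> i h"
  using assms finite_index by (simp add: descend_apply sum.remove[of I i] algebra_simps)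

lemma descend_Suc: "i \<in> I \<Longrightarrow> descend \<mu> (n(i := Suc (n i))) = descend \<mu> n - \<alpha> i"
  by (simp add: fun_eq_iff descend_upd)

abbreviation monomial :: "'v \<Rightarrow> 'i list \<Rightarrow> 'v" where "monomial u js \<equiv> foldr f js u"

lemma monomial_Wt:
  "u \<in> Wt \<mu> \<Longrightarrow> set js \<subseteq> I \<Longrightarrow> monomial u js \<in> Wt (descend \<mu> (count_list js))"
proof (induction js)
  case (Cons j js)
  have "count_list (j # js) = (count_list js)(j := Suc (count_list js j))" by auto
  then have "descend \<mu> (count_list (j # js)) = descend \<mu> (count_list js) - \<alpha> j"
    using Cons.prems by (simp only: descend_Suc) (simp add: descend_Suc)
  moreover have "f j (monomial u js) \<in> Wt (descend \<mu> (count_list js) - \<alpha> j)"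
    using Cons by (intro f_Wt) auto
  ultimately show ?case by (simp only: foldr.simps comp_apply)
next
  case Nil
  have "count_list [] = (\<lambda>_::'i. 0)" by auto
  then show ?case using Nil by simp
qed

text \<open>\<open>e i\<close> can be moved past each \<open>f j\<close> until it kills
  \<open>u\<close>. Each commutator on the way is 0 or a coroot, which acts on the remaining
  monomial by a scalar.\<close>

lemma submodule_monomials:
  assumes u: "u \<in> Wt \<mu>" and singular: "\<And>i. i \<in> I \<Longrightarrow> e i u = 0"
  shows "submodule vs act (M.V.span (monomial u ` {js. set js \<subseteq> I}))" (is "submodule vs act (M.V.span ?B)")
proof (rule submoduleI)
  have stable: "T w \<in> M.V.span ?B"
    if T: "module_hom vs vs T" and B: "\<And>b. b \<in> ?B \<Longrightarrow> T b \<in> M.V.span ?B" and w: "w \<in> M.V.span ?B" for T w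
    using w
  proof (induction rule: M.V.span_induct_alt)
    case base
    then show ?case by (simp add: module_hom.zero[OF T] M.V.span_zero)
  next
    case (step c b y)
    then show ?case
      by (simp add: module_hom.add[OF T] module_hom.scale[OF T] M.V.span_add M.V.span_scale B)
  qed
  show "M.V.subspace (M.V.span ?B)" by (rule M.V.subspace_span)
  have HB: "H h (monomial u js) \<in> M.V.span ?B" if "set js \<subseteq> I" for h js
  proof -
    have "H h (monomial u js) = vs (descend \<mu> (count_list js) h) (monomial u js)"
      using monomial_Wt[OF u that] by (simp add: weight_space_def)
    moreover have "monomial u js \<in> M.V.span ?B" using that by (auto intro: M.V.span_base)
    ultimately show ?thesis by (simp add: M.V.span_scale)
  qed
  show "H h w \<in> M.V.span ?B" if "w \<in> M.V.span ?B" for h w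
    by (rule stable[OF act_hom _ that]) (use HB in auto)
  have fB: "f i w \<in> M.V.span ?B" if "i \<in> I" "w \<in> M.V.span ?B" for i w
  proof (rule stable[OF act_hom _ that(2)])
    fix b assume "b \<in> ?B"
    then obtain js where "set js \<subseteq> I" "b = monomial u js" by blast
    then have "f i b = monomial u (i # js)" "set (i # js) \<subseteq> I" using that by auto
    then show "f i b \<in> M.V.span ?B" by (intro M.V.span_base image_eqI[of _ _ "i # js"]) auto
  qed
  then show "\<And>i w. i \<in> I \<Longrightarrow> w \<in> M.V.span ?B \<Longrightarrow> f i w \<in> M.V.span ?B" .
  have eB: "e i (monomial u js) \<in> M.V.span ?B" if i: "i \<in> I" and js: "set js \<subseteq> I" for i js
    using js
  proof (induction js)
    case Nil
    then show ?case using singular[OF i] by (simp add: M.V.span_zero)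
  next
    case (Cons j js)
    then show ?case using fB HB i by (auto simp: e_f M.V.span_add)
  qed
  show "e i w \<in> M.V.span ?B" if "i \<in> I" "w \<in> M.V.span ?B" for i w
    by (rule stable[OF act_hom _ that(2)]) (use eB that(1) in auto)
qed

section \<open>Root strings from the representation theory of sl2\<close>

text \<open>Instantiated with \<open>(a, b) = (e i, f i)\<close> and with \<open>(f i, e i)\<close>.\<close>

lemma sl2_string:
  assumes "act a y = 0"
    and "\<And>k. act (br a b) ((act b ^^ k) y) = vs (c - 2 * of_nat k) ((act b ^^ k) y)"
  shows "act a ((act b ^^ Suc k) y) = vs (of_nat (Suc k) * (c - of_nat k)) ((act b ^^ k) y)"
proof (induction k)
  case 0
  then show ?case using assms(1) assms(2)[of 0] M.act_bracket[of a b y] by simp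
next
  case (Suc k)
  have "act a ((act b ^^ Suc (Suc k)) y) = act b (act a ((act b ^^ Suc k) y)) +
      act (br a b) ((act b ^^ Suc k) y)"
    by (simp add: M.act_bracket)
  also have "\<dots> = vs (of_nat (Suc k) * (c - of_nat k) + (c - 2 * of_nat (Suc k))) ((act b ^^ Suc k) y)"
    unfolding Suc.IH assms(2) by (simp add: act_scale M.V.scale_left_distrib)
  also have "of_nat (Suc k) * (c - of_nat k) + (c - 2 * of_nat (Suc k)) =
      of_nat (Suc (Suc k)) * (c - of_nat (Suc k))"
    by (simp add: algebra_simps)
  finally show ?case .
qed

text \<open>The factor in \<open>sl2_string\<close> vanishes only when \<open>c\<close> equals
  \<open>k\<close>, so up to there \<open>a\<close> recovers each power from the next.\<close>

lemma sl2_string_nonzero: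
  assumes "act a y = 0" "y \<noteq> 0"
    and "\<And>k. act (br a b) ((act b ^^ k) y) = vs (c - 2 * of_nat k) ((act b ^^ k) y)"
    and "\<And>j. j < k \<Longrightarrow> c \<noteq> of_nat j"
  shows "(act b ^^ k) y \<noteq> 0"
  using assms(4)
proof (induction k)
  case 0
  then show ?case using assms(2) by simp
next
  case (Suc k)
  then have "vs (of_nat (Suc k) * (c - of_nat k)) ((act b ^^ k) y) \<noteq> 0"
    by (auto simp: M.V.scale_eq_0_iff simp del: of_nat_Suc)
  then show ?case using sl2_string[OF assms(1,3), of k] by (metis act_zero)
qed

lemma funpow_e_Wt: "i \<in> I \<Longrightarrow> x \<in> Wt \<mu> \<Longrightarrow> (e i ^^ k) x \<in> Wt (\<lambda>h. \<mu> h + of_nat k * \<alpha> i h)"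
proof (induction k)
  case (Suc k)
  then have "e i ((e i ^^ k) x) \<in> Wt ((\<lambda>h. \<mu> h + of_nat k * \<alpha> i h) + \<alpha> i)"
    by (intro e_Wt) auto
  then show ?case by (simp add: plus_fun_def algebra_simps)
qed simp

lemma funpow_f_Wt: "i \<in> I \<Longrightarrow> x \<in> Wt \<mu> \<Longrightarrow> (f i ^^ k) x \<in> Wt (\<lambda>h. \<mu> h - of_nat k * \<alpha> i h)"
proof (induction k)
  case (Suc k)
  then have "f i ((f i ^^ k) x) \<in> Wt ((\<lambda>h. \<mu> h - of_nat k * \<alpha> i h) - \<alpha> i)"
    by (intro f_Wt) auto
  then show ?case by (simp add: fun_diff_def algebra_simps)
qed simp

lemma alpha_coroot: "i \<in> I \<Longrightarrow> \<alpha> i (coroot i) = 2"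
  using pairing[of i i] diagonal[of i] by simp

lemma br_e_f_pow:
  assumes "i \<in> I" "y \<in> Wt \<mu>"
  shows "act (br (gen (E i)) (gen (F i))) ((f i ^^ k) y) = vs (\<mu> (coroot i) - 2 * of_nat k) ((f i ^^ k) y)"
  using funpow_f_Wt[OF assms, of k] assms(1)
  by (simp add: gen_E_F weight_space_def alpha_coroot mult.commute)

lemma br_f_e_pow:
  assumes "i \<in> I" "y \<in> Wt \<mu>"
  shows "act (br (gen (F i)) (gen (E i))) ((e i ^^ k) y) = vs (- \<mu> (coroot i) - 2 * of_nat k) ((e i ^^ k) y)"
proof -
  have "act (br (gen (F i)) (gen (E i))) x = - act (br (gen (E i)) (gen (F i))) x" for x
    by (simp add: M.act_bracket)
  then show ?thesis
    using funpow_e_Wt[OF assms, of k] assms(1)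
    by (simp add: gen_E_F weight_space_def alpha_coroot mult.commute flip: M.V.scale_minus_left)
qed

text \<open>Applying \<open>e i\<close> as often as possible gives a highest weight vector; the string descending
  from it passes through both \<open>\<mu>\<close> and its reflection.\<close>

lemma string_down:
  assumes i: "i \<in> I" and x: "x \<in> Wt \<mu>" "x \<noteq> 0"
    and nil: "\<exists>n. (e i ^^ n) x = 0" and m: "\<mu> (coroot i) = of_nat m" and k: "k \<le> m"
  shows "\<exists>y\<noteq>0. y \<in> Wt (\<lambda>h. \<mu> h - of_nat k * \<alpha> i h)"
proof -
  obtain p where p: "(e i ^^ p) x \<noteq> 0" "(e i ^^ Suc p) x = 0"
  proof -
    obtain n where "(e i ^^ n) x = 0" using nil by blast
    then have "\<exists>p<n. (\<forall>j\<le>p. (e i ^^ j) x \<noteq> 0) \<and> (e i ^^ Suc p) x = 0"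
      using ex_least_nat_less[of "\<lambda>n. (e i ^^ n) x = 0" n] x(2) by simp
    then show ?thesis using that by blast
  qed
  define y where "y = (e i ^^ p) x"
  have y: "y \<in> Wt (\<lambda>h. \<mu> h + of_nat p * \<alpha> i h)" unfolding y_def by (rule funpow_e_Wt[OF i x(1)])
  \<comment> \<open>Each \<open>e i\<close> raises the coroot value by 2, so it is
    \<open>m + 2 * p\<close> at \<open>y\<close>, and the string cannot break within that many
    steps. The first \<open>p\<close> lead back to \<mu>, the other \<open>k\<close> below
    it.\<close>
  have "(f i ^^ (p + k)) y \<noteq> 0"
  proof (rule sl2_string_nonzero)
    show "e i y = 0" "y \<noteq> 0" using p by (auto simp: y_def)
    show "act (br (gen (E i)) (gen (F i))) ((f i ^^ k) y) =
        vs (of_nat (m + 2 * p) - 2 * of_nat k) ((f i ^^ k) y)" for k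
      using br_e_f_pow[OF i y] i m by (simp add: alpha_coroot mult.commute)
    show "of_nat (m + 2 * p) \<noteq> (of_nat j :: complex)" if "j < p + k" for j
      using that k by (simp only: of_nat_eq_iff)
  qed
  moreover have "(f i ^^ (p + k)) y \<in> Wt (\<lambda>h. \<mu> h - of_nat k * \<alpha> i h)"
    using funpow_f_Wt[OF i y, of "p + k"] by (simp add: algebra_simps)
  ultimately show ?thesis by blast
qed

lemma string_up:
  assumes i: "i \<in> I" and x: "x \<in> Wt \<mu>" "x \<noteq> 0"
    and nil: "\<exists>n. (f i ^^ n) x = 0" and m: "\<mu> (coroot i) = - of_nat m" and k: "k \<le> m"
  shows "\<exists>y\<noteq>0. y \<in> Wt (\<lambda>h. \<mu> h + of_nat k * \<alpha> i h)"
proof -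
  obtain p where p: "(f i ^^ p) x \<noteq> 0" "(f i ^^ Suc p) x = 0"
  proof -
    obtain n where "(f i ^^ n) x = 0" using nil by blast
    then have "\<exists>p<n. (\<forall>j\<le>p. (f i ^^ j) x \<noteq> 0) \<and> (f i ^^ Suc p) x = 0"
      using ex_least_nat_less[of "\<lambda>n. (f i ^^ n) x = 0" n] x(2) by simp
    then show ?thesis using that by blast
  qed
  define y where "y = (f i ^^ p) x"
  have y: "y \<in> Wt (\<lambda>h. \<mu> h - of_nat p * \<alpha> i h)" unfolding y_def by (rule funpow_f_Wt[OF i x(1)])
  have "(e i ^^ (p + k)) y \<noteq> 0"
  proof (rule sl2_string_nonzero)
    show "f i y = 0" "y \<noteq> 0" using p by (auto simp: y_def)
    show "act (br (gen (F i)) (gen (E i))) ((e i ^^ k) y) =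
        vs (of_nat (m + 2 * p) - 2 * of_nat k) ((e i ^^ k) y)" for k
      using br_f_e_pow[OF i y] i m by (simp add: alpha_coroot mult.commute)
    show "of_nat (m + 2 * p) \<noteq> (of_nat j :: complex)" if "j < p + k" for j
      using that k by (simp only: of_nat_eq_iff)
  qed
  moreover have "(e i ^^ (p + k)) y \<in> Wt (\<lambda>h. \<mu> h + of_nat k * \<alpha> i h)"
    using funpow_e_Wt[OF i y, of "p + k"] by (simp add: algebra_simps)
  ultimately show ?thesis by blast
qed

end

section \<open>Simple highest weight modules\<close>

lemma sum_cfun_scale_apply: "(\<Sum>i\<in>S. cfun_scale (c i) (g i)) h = (\<Sum>i\<in>S. c i * g i h)"
  by (induction S rule: infinite_finite_induct) (auto simp: cfun_scale_def)

locale simple_highest_weight_module = km_module I A hs \<alpha> coroot gs br gen vs act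
  for I :: "'i set" and A :: "'i \<Rightarrow> 'i \<Rightarrow> int"
    and hs :: "complex \<Rightarrow> 'h::ab_group_add \<Rightarrow> 'h"
    and \<alpha> :: "'i \<Rightarrow> 'h \<Rightarrow> complex" and coroot :: "'i \<Rightarrow> 'h"
    and gs :: "complex \<Rightarrow> 'g::ab_group_add \<Rightarrow> 'g" and br :: "'g \<Rightarrow> 'g \<Rightarrow> 'g"
    and gen :: "('h, 'i) km_gen \<Rightarrow> 'g"
    and vs :: "complex \<Rightarrow> 'v::ab_group_add \<Rightarrow> 'v" and act :: "'g \<Rightarrow> 'v \<Rightarrow> 'v" +
  fixes \<Lambda> :: "'h \<Rightarrow> complex" and v :: 'v
  assumes highest_dual: "\<Lambda> \<in> dual hs"
    and simple: "simple_module vs act"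
    and v_nonzero: "v \<noteq> 0" and v_Wt: "v \<in> Wt \<Lambda>"
    and e_v: "i \<in> I \<Longrightarrow> e i v = 0"
    and v_generates: "submodule vs act W \<Longrightarrow> v \<in> W \<Longrightarrow> W = UNIV"
begin

lemma submodule_cases: "submodule vs act W \<Longrightarrow> W = {0} \<or> W = UNIV"
  using simple by (auto simp: simple_module_def)

section \<open>Coefficient vectors of the weights\<close>

lemma roots_independentD:
  assumes "(\<Sum>i\<in>I. cfun_scale (c i) (\<alpha> i)) = 0" "i \<in> I"
  shows "c i = 0"
proof -
  interpret D: vector_space cfun_scale by (rule vector_space_cfun_scale)
  have "(\<Sum>a\<in>\<alpha> ` I. cfun_scale (c (the_inv_into I \<alpha> a)) a) = (\<Sum>i\<in>I. cfun_scale (c i) (\<alpha> i))"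
    unfolding sum.reindex[OF roots_inj]
    by (intro sum.cong) (simp_all add: the_inv_into_f_f[OF roots_inj])
  then have "c (the_inv_into I \<alpha> (\<alpha> i)) = 0"
    using D.independentD[OF roots_independent, of "\<alpha> ` I" "\<lambda>a. c (the_inv_into I \<alpha> a)" "\<alpha> i"]
      assms finite_index by auto
  then show ?thesis by (simp add: the_inv_into_f_f[OF roots_inj assms(2)])
qed

lemma descend_inj:
  assumes "descend \<mu> m = descend \<mu> n" "i \<in> I"
  shows "m i = n i"
proof -
  have "(\<Sum>i\<in>I. cfun_scale (of_nat (m i) - of_nat (n i)) (\<alpha> i)) = 0"
    using assms(1)
    by (simp add: fun_eq_iff descend_apply sum_cfun_scale_apply left_diff_distrib sum_subtractf)
  from roots_independentD[OF this assms(2)] show ?thesis by simp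
qed

text \<open>Only the values on \<open>I\<close> enter \<open>descend\<close>; fixing the others as 0
  makes a member of \<open>N\<close> determined by its weight.\<close>

definition N :: "('i \<Rightarrow> nat) set"
  where "N = {n. (\<forall>i. i \<notin> I \<longrightarrow> n i = 0) \<and> (\<exists>x\<noteq>0. x \<in> Wt (descend \<Lambda> n))}"

lemma N_I: "(\<And>i. i \<notin> I \<Longrightarrow> n i = 0) \<Longrightarrow> x \<noteq> 0 \<Longrightarrow> x \<in> Wt (descend \<Lambda> n) \<Longrightarrow> n \<in> N"
  by (auto simp: N_def)

lemma count_list_mem_N:
  assumes "set js \<subseteq> I" "monomial v js \<noteq> 0"
  shows "count_list js \<in> N"
  using assms by (intro N_I[OF _ assms(2)] monomial_Wt[OF v_Wt]) (auto simp: count_list_0_iff)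

text \<open>The monomials applied to \<open>v\<close> span the module and are weight vectors, so a
  weight that occurs at all occurs on a nonzero monomial.\<close>

lemma weight_monomial:
  assumes "x \<noteq> 0" "x \<in> Wt \<mu>"
  shows "\<exists>js. set js \<subseteq> I \<and> monomial v js \<noteq> 0 \<and> \<mu> = descend \<Lambda> (count_list js)"
proof -
  let ?B = "monomial v ` {js. set js \<subseteq> I}"
  have "v \<in> M.V.span ?B" by (intro M.V.span_base image_eqI[of _ _ "[]"]) auto
  then have "x \<in> M.V.span ?B" using v_generates[OF submodule_monomials[OF v_Wt e_v]] by auto
  then obtain b where "b \<in> ?B" "b \<noteq> 0" "b \<in> Wt \<mu>"
    using weight_vector_in_span[OF _ assms(2,1), of ?B] monomial_Wt[OF v_Wt] by blast
  then show ?thesis using Wt_unique monomial_Wt[OF v_Wt] by blast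
qed

lemma descend_dual: "descend \<Lambda> n \<in> dual hs"
proof -
  have lin: "\<mu> (x + y) = \<mu> x + \<mu> y \<and> \<mu> (hs c x) = c * \<mu> x" if "\<mu> \<in> dual hs" for \<mu> x y c
    using that by (auto simp: dual_def Vector_Spaces.linear_iff)
  have "vector_space hs" "vector_space ((*) :: complex \<Rightarrow> _)"
    using highest_dual by (auto simp: dual_def Vector_Spaces.linear_iff)
  then show ?thesis
    by (simp add: dual_def Vector_Spaces.linear_iff descend_apply lin[OF highest_dual] lin[OF root_dual]
        sum.distrib sum_distrib_left algebra_simps)
qed

lemma wt_eq: "wt hs gen vs act = descend \<Lambda> ` N"
proof
  show "wt hs gen vs act \<subseteq> descend \<Lambda> ` N"
  proof
    fix \<mu> assume "\<mu> \<in> wt hs gen vs act"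
    moreover have "0 \<in> Wt \<mu>" by (rule M.V.subspace_0[OF Wt_subspace])
    ultimately obtain x where "x \<noteq> 0" "x \<in> Wt \<mu>" unfolding wt_def by blast
    then show "\<mu> \<in> descend \<Lambda> ` N" using weight_monomial count_list_mem_N by blast
  qed
  show "descend \<Lambda> ` N \<subseteq> wt hs gen vs act"
    using descend_dual by (auto simp: N_def wt_def)
qed

text \<open>By simplicity the monomials applied to \<open>u\<close> span zero or everything. In the
  latter case \<Lambda> would arise from \<open>descend \<Lambda> n\<close> by subtracting simple
  roots, which \<open>n i > 0\<close> rules out.\<close>

lemma singular_eq_0:
  assumes u: "u \<in> Wt (descend \<Lambda> n)" and e: "\<And>j. j \<in> I \<Longrightarrow> e j u = 0"
    and i: "i \<in> I" "n i > 0"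
  shows "u = 0"
proof -
  let ?B = "monomial u ` {js. set js \<subseteq> I}"
  from submodule_cases[OF submodule_monomials[OF u e]]
  show ?thesis
  proof
    assume "M.V.span ?B = {0}"
    moreover have "u \<in> M.V.span ?B" by (intro M.V.span_base image_eqI[of _ _ "[]"]) auto
    ultimately show ?thesis by simp
  next
    assume "M.V.span ?B = UNIV"
    then obtain js where js: "set js \<subseteq> I" "monomial u js \<noteq> 0" "monomial u js \<in> Wt \<Lambda>"
      using weight_vector_in_span[OF _ v_Wt v_nonzero, of ?B] monomial_Wt[OF u] by blast
    then have "\<Lambda> = descend (descend \<Lambda> n) (count_list js)"
      using Wt_unique monomial_Wt[OF u js(1)] by blast
    then have "descend \<Lambda> (\<lambda>_. 0) = descend \<Lambda> (\<lambda>i. n i + count_list js i)"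
      by (simp add: descend_add)
    from descend_inj[OF this i(1)] show ?thesis using i(2) by simp
  qed
qed

section \<open>Nilpotent and injective lowering operators\<close>

definition J :: "'i set"
  where "J = {i \<in> I. \<Lambda> (coroot i) \<in> \<nat>}"

text \<open>Only the values of \<open>b\<close> on \<open>J\<close> are meaningful.\<close>

definition b :: "'i \<Rightarrow> int"
  where "b i = \<lfloor>Re (\<Lambda> (coroot i))\<rfloor>"

lemma J_b: "i \<in> J \<Longrightarrow> \<Lambda> (coroot i) = of_int (b i) \<and> b i \<ge> 0"
  by (auto simp: J_def b_def Nats_def)

lemma descend_coroot:
  assumes "i \<in> J"
  shows "descend \<Lambda> n (coroot i) = of_int (b i - (\<Sum>j\<in>I. A i j * int (n j)))"
proof -
  have "(\<Sum>j\<in>I. of_nat (n j) * \<alpha> j (coroot i)) = (\<Sum>j\<in>I. of_int (A i j * int (n j)))"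
    using assms by (intro sum.cong) (auto simp: pairing J_def)
  then show ?thesis using J_b[OF assms] by (simp add: descend_apply)
qed

text \<open>With \<Lambda> equal to \<open>m\<close> on the coroot, \<open>f i\<close> applied
  \<open>Suc m\<close> times to \<open>v\<close> gives a singular vector: for \<open>e i\<close> the
  factor in \<open>sl2_string\<close> is 0, and the other \<open>e j\<close> commute with
  \<open>f i\<close>. So it is zero, and the submodule of locally nilpotent vectors contains
  \<open>v\<close>.\<close>

lemma f_nilpotent:
  assumes i: "i \<in> J"
  shows "\<exists>n. (f i ^^ n) x = 0"
proof -
  have iI: "i \<in> I" using i by (simp add: J_def)
  obtain m where m: "\<Lambda> (coroot i) = of_nat m" using i by (auto simp: J_def Nats_def)
  have "(f i ^^ Suc m) v = 0"
  proof (rule singular_eq_0)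
    have eq: "descend \<Lambda> ((\<lambda>_. 0)(i := Suc m)) = (\<lambda>h. \<Lambda> h - of_nat (Suc m) * \<alpha> i h)"
      by (rule ext) (subst descend_upd[OF iI], simp)
    show "(f i ^^ Suc m) v \<in> Wt (descend \<Lambda> ((\<lambda>_. 0)(i := Suc m)))"
      unfolding eq by (rule funpow_f_Wt[OF iI v_Wt])
    show "i \<in> I" "((\<lambda>_. 0)(i := Suc m)) i > 0" using iI by auto
    fix j assume j: "j \<in> I"
    show "e j ((f i ^^ Suc m) v) = 0"
    proof (cases "j = i")
      case True
      have "e i ((f i ^^ Suc m) v) = vs (of_nat (Suc m) * (of_nat m - of_nat m)) ((f i ^^ m) v)"
        using br_e_f_pow[OF iI v_Wt] by (intro sl2_string) (auto simp: e_v[OF iI] m)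
      then show ?thesis using True by simp
    next
      case False
      have "e j ((f i ^^ k) v) = 0" for k
        by (induction k) (simp_all add: e_f[OF j iI] e_v[OF j] False)
      then show ?thesis .
    qed
  qed
  then have "v \<in> {x. \<exists>n. (f i ^^ n) x = 0}" by blast
  from v_generates[OF submodule_f_nilpotent[OF iI] this] show ?thesis by blast
qed

text \<open>Off \<open>J\<close> the factors in \<open>sl2_string\<close> never vanish, so no power
  of \<open>f i\<close> kills \<open>v\<close>. The submodule of locally nilpotent vectors, which
  contains the kernel of \<open>f i\<close>, is therefore proper, hence zero.\<close>

lemma f_injective:
  assumes i: "i \<in> I - J" and x: "f i x = 0"
  shows "x = 0"
proof -
  have iI: "i \<in> I" using i by simp
  have "(f i ^^ n) v \<noteq> 0" for n
    using i br_e_f_pow[OF iI v_Wt]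
    by (intro sl2_string_nonzero[where a = "gen (E i)" and c = "\<Lambda> (coroot i)"])
      (auto simp: e_v v_nonzero J_def)
  then have "{x. \<exists>n. (f i ^^ n) x = 0} \<noteq> UNIV" by blast
  then have "{x. \<exists>n. (f i ^^ n) x = 0} = {0}"
    using submodule_cases[OF submodule_f_nilpotent[OF iI]] by blast
  moreover have "(f i ^^ 1) x = 0" using x by simp
  ultimately show ?thesis by blast
qed

text \<open>Every weight lies below \<Lambda>, so raising by \<open>k\<close> copies of
  \<open>\<alpha> i\<close> leaves a natural coefficient. Writing \<open>n\<close> through
  \<open>m\<close> avoids truncated subtraction.\<close>

lemma weight_raised:
  assumes n: "\<And>i. i \<notin> I \<Longrightarrow> n i = 0" and i: "i \<in> I"
    and x: "x \<noteq> 0" "x \<in> Wt (\<lambda>h. descend \<Lambda> n h + of_nat k * \<alpha> i h)"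
  shows "\<exists>m\<in>N. n = m(i := m i + k)"
proof -
  from weight_monomial[OF x] obtain js where js: "set js \<subseteq> I" "monomial v js \<noteq> 0"
      "(\<lambda>h. descend \<Lambda> n h + of_nat k * \<alpha> i h) = descend \<Lambda> (count_list js)"
    by blast
  let ?m = "count_list js"
  have "descend \<Lambda> n h = descend \<Lambda> (?m(i := ?m i + k)) h" for h
    using fun_cong[OF js(3), of h] by (simp add: descend_upd[OF i] algebra_simps del: fun_upd_apply)
  then have eq: "descend \<Lambda> n = descend \<Lambda> (?m(i := ?m i + k))" by blast
  have mN: "?m \<in> N" by (rule count_list_mem_N[OF js(1,2)])
  have "n j = (?m(i := ?m i + k)) j" for j
    using descend_inj[OF eq, of j] n[of j] i mN by (cases "j \<in> I") (auto simp: N_def)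
  then show ?thesis using mN by blast
qed

text \<open>Otherwise some weight would have coefficient -1 at \<open>i\<close>.\<close>

lemma e_nilpotent:
  assumes i: "i \<in> I" and x: "x \<in> Wt (descend \<Lambda> n)" and n: "\<And>i. i \<notin> I \<Longrightarrow> n i = 0"
  shows "(e i ^^ Suc (n i)) x = 0"
proof (rule ccontr)
  assume "(e i ^^ Suc (n i)) x \<noteq> 0"
  from weight_raised[OF n i this funpow_e_Wt[OF i x]]
  show False by (metis add_Suc_right fun_upd_same less_add_Suc2 less_irrefl)
qed

sublocale coefficient_set I J A b N
proof
  show "finite I" by (rule finite_index)
  show "i \<in> I \<Longrightarrow> A i i = 2" for i by (rule diagonal)
  show "i \<in> I \<Longrightarrow> j \<in> I \<Longrightarrow> i \<noteq> j \<Longrightarrow> A i j \<le> 0" for i j by (rule off_diagonal)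
  show "J \<subseteq> I" by (auto simp: J_def)
  show "i \<in> J \<Longrightarrow> 0 \<le> b i" for i using J_b by blast
  show "(\<lambda>_. 0) \<in> N" using v_nonzero v_Wt by (auto intro: N_I)
  show "n \<in> N \<Longrightarrow> i \<notin> I \<Longrightarrow> n i = 0" for n i by (simp add: N_def)
next
  fix n assume n: "n \<in> N" "n \<noteq> (\<lambda>_. 0)"
  then obtain x where x: "x \<noteq> 0" "x \<in> Wt (descend \<Lambda> n)" by (auto simp: N_def)
  from weight_monomial[OF this] obtain js
    where js: "set js \<subseteq> I" "monomial v js \<noteq> 0" "descend \<Lambda> n = descend \<Lambda> (count_list js)" by blast
  have n_eq: "n = count_list js"
  proof
    fix i
    show "n i = count_list js i"
      using descend_inj[OF js(3), of i] n(1) js(1)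
      by (cases "i \<in> I") (auto simp: N_def count_list_0_iff)
  qed
  \<comment> \<open>The outermost letter of the word gives the last step; the tail is nonzero
    because its image under \<open>f j\<close> is.\<close>
  then obtain j js' where Cons: "js = j # js'" using n(2) by (cases js) auto
  have "count_list js' \<in> N" using js by (intro count_list_mem_N) (auto simp: Cons)
  moreover have "n = (count_list js')(j := Suc (count_list js' j))" by (auto simp: n_eq Cons)
  ultimately show "\<exists>i\<in>I. \<exists>m\<in>N. n = m(i := Suc (m i))" using js(1) Cons by auto
next
  fix n i assume n: "n \<in> N" and i: "i \<in> I - J"
  then obtain x where "x \<noteq> 0" "x \<in> Wt (descend \<Lambda> n)" by (auto simp: N_def)
  moreover from this i have "f i x \<noteq> 0" using f_injective by blast
  ultimately show "n(i := Suc (n i)) \<in> N"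
    using n i f_Wt[of i x "descend \<Lambda> n"]
    by (intro N_I[of _ "f i x"]) (auto simp: N_def descend_Suc)
next
  \<comment> \<open>This serves two axioms: \<open>k = 1\<close> gives the string step,
    \<open>k = m\<close> the reflection for a nonnegative pairing.\<close>
  have down: "n(i := n i + k) \<in> N"
    if "n \<in> N" "i \<in> J" "b i - (\<Sum>j\<in>I. A i j * int (n j)) = int m" "k \<le> m" for n i m k
  proof -
    have iI: "i \<in> I" using that(2) by (simp add: J_def)
    from that(1) obtain x where x: "x \<noteq> 0" "x \<in> Wt (descend \<Lambda> n)"
      and supp: "\<And>i. i \<notin> I \<Longrightarrow> n i = 0" by (auto simp: N_def)
    have "descend \<Lambda> n (coroot i) = of_nat m"
      using descend_coroot[OF that(2), of n] unfolding that(3) by simp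
    from string_down[OF iI x(2,1) _ this that(4)] e_nilpotent[OF iI x(2) supp]
    obtain y where y: "y \<noteq> 0" "y \<in> Wt (\<lambda>h. descend \<Lambda> n h - of_nat k * \<alpha> i h)" by blast
    have "descend \<Lambda> (n(i := n i + k)) = (\<lambda>h. descend \<Lambda> n h - of_nat k * \<alpha> i h)"
      by (rule ext) (subst descend_upd[OF iI], simp)
    then show ?thesis using y supp iI by (intro N_I[OF _ y(1)]) auto
  qed
  fix n i assume n: "n \<in> N" and i: "i \<in> J"
  have iI: "i \<in> I" using i by (simp add: J_def)
  let ?p = "b i - (\<Sum>j\<in>I. A i j * int (n j))"
  show "n(i := Suc (n i)) \<in> N" if "?p > 0"
    using down[OF n i, of "nat ?p" 1] that by simp
  show "\<exists>k. int k = int (n i) + ?p \<and> n(i := k) \<in> N"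
  proof (cases "?p \<ge> 0")
    case True
    then show ?thesis using down[OF n i, of "nat ?p" "nat ?p"] by (intro exI[of _ "n i + nat ?p"]) auto
  next
    case False
    define m where "m = nat (- ?p)"
    have p: "?p = - int m" using False by (simp add: m_def)
    from n obtain x where x: "x \<noteq> 0" "x \<in> Wt (descend \<Lambda> n)"
      and supp: "\<And>i. i \<notin> I \<Longrightarrow> n i = 0" by (auto simp: N_def)
    have "descend \<Lambda> n (coroot i) = - of_nat m"
      using descend_coroot[OF i, of n] unfolding p by simp
    \<comment> \<open>A negative pairing needs the ascending string, available because
      \<open>f i\<close> is locally nilpotent.\<close>
    from string_up[OF iI x(2,1) f_nilpotent[OF i] this order_refl]
    obtain y where "y \<noteq> 0" "y \<in> Wt (\<lambda>h. descend \<Lambda> n h + of_nat m * \<alpha> i h)" by blast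
    from weight_raised[OF supp iI this] obtain q where q: "q \<in> N" "n = q(i := q i + m)" by blast
    have "int (q i) = int (n i) + ?p" unfolding p using q(2) by simp
    moreover have "n(i := q i) = q" using q(2) by simp
    ultimately show ?thesis using q(1) by (intro exI[of _ "q i"]) simp
  qed
qed

text \<open>The weights are the image of \<open>N\<close> under the affine map from \<open>x\<close>
  to \<open>\<Lambda> + L x\<close>, and hulls commute with affine maps. Independence of the roots
  makes coefficients unique, so a hull point below \<Lambda> comes from an integral point of
  \<open>hull_N\<close>, where \<open>hull_N_mem\<close> applies.\<close>

lemma wt_saturated:
  "wt hs gen vs act = (convex hull (wt hs gen vs act)) \<inter> {\<mu> \<in> dual hs. weight_le I \<alpha> \<mu> \<Lambda>}"
proof
  show "wt hs gen vs act \<subseteq> (convex hull (wt hs gen vs act)) \<inter> {\<mu> \<in> dual hs. weight_le I \<alpha> \<mu> \<Lambda>}"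
    using descend_dual by (auto simp: hull_inc wt_eq weight_le_def descend_def)
next
  define L where "L = (\<lambda>x :: 'i \<Rightarrow> real. \<Sum>i\<in>I. cfun_scale (- of_real (x i)) (\<alpha> i))"
  have L_apply: "L x h = - (\<Sum>i\<in>I. of_real (x i) * \<alpha> i h)" for x h
    by (simp add: L_def sum_cfun_scale_apply sum_negf)
  have L: "linear L"
    by (rule linearI; rule ext)
      (simp_all add: L_apply sum.distrib algebra_simps scaleR_fun_def scaleR_conv_of_real sum_distrib_left)
  have descend_L: "descend \<Lambda> n = \<Lambda> + L (\<lambda>i. real (n i))" for n
    by (simp add: fun_eq_iff descend_apply L_apply)
  have "wt hs gen vs act = (\<lambda>y. \<Lambda> + y) ` L ` (\<lambda>n i. real (n i)) ` N"
    by (simp add: wt_eq descend_L image_image)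
  then have hull_wt: "convex hull (wt hs gen vs act) = (\<lambda>y. \<Lambda> + y) ` L ` hull_N"
    by (simp add: convex_hull_translation convex_hull_linear_image[OF L] hull_N_def)
  show "(convex hull (wt hs gen vs act)) \<inter> {\<mu> \<in> dual hs. weight_le I \<alpha> \<mu> \<Lambda>} \<subseteq> wt hs gen vs act"
  proof
    fix \<mu> assume \<mu>: "\<mu> \<in> (convex hull (wt hs gen vs act)) \<inter> {\<mu> \<in> dual hs. weight_le I \<alpha> \<mu> \<Lambda>}"
    then obtain x where x: "x \<in> hull_N" "\<mu> = \<Lambda> + L x" unfolding hull_wt by blast
    from \<mu> obtain n' where "\<Lambda> - \<mu> = (\<Sum>i\<in>I. cfun_scale (of_nat (n' i)) (\<alpha> i))"
      by (auto simp: weight_le_def)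
    then have n': "\<mu> = descend \<Lambda> n'" by (simp add: descend_def algebra_simps)
    define n where "n = (\<lambda>i. if i \<in> I then n' i else 0)"
    have \<mu>n: "\<mu> = descend \<Lambda> n" unfolding n' descend_def n_def by simp
    have "L x = L (\<lambda>i. real (n i))" using \<mu>n x(2) by (simp add: descend_L)
    then have "(\<Sum>i\<in>I. cfun_scale (of_real (x i - real (n i))) (\<alpha> i)) = 0"
      by (simp add: fun_eq_iff L_apply sum_cfun_scale_apply left_diff_distrib sum_subtractf)
    from roots_independentD[OF this] have "x i - real (n i) = 0" if "i \<in> I" for i
      using that by (simp only: of_real_eq_0_iff)
    then have "x i = real (n i)" for i
      using hull_N_support[OF x(1), of i] by (cases "i \<in> I") (auto simp: n_def)
    then have "x = (\<lambda>i. real (n i))" by blast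
    then show "\<mu> \<in> wt hs gen vs act" using hull_N_mem x(1) unfolding wt_eq \<mu>n by blast
  qed
qed

end

theorem proposition2p5:
  fixes I :: "'i set" and A :: "'i \<Rightarrow> 'i \<Rightarrow> int"
    and hs :: "complex \<Rightarrow> 'h::ab_group_add \<Rightarrow> 'h"
    and \<alpha> :: "'i \<Rightarrow> 'h \<Rightarrow> complex" and coroot :: "'i \<Rightarrow> 'h"
    and gs :: "complex \<Rightarrow> 'g::ab_group_add \<Rightarrow> 'g" and br :: "'g \<Rightarrow> 'g \<Rightarrow> 'g"
    and gen :: "('h, 'i) km_gen \<Rightarrow> 'g"
    and vs :: "complex \<Rightarrow> 'v::ab_group_add \<Rightarrow> 'v" and act :: "'g \<Rightarrow> 'v \<Rightarrow> 'v"
    and \<Lambda> :: "'h \<Rightarrow> complex"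
  assumes "kac_moody_algebra I A hs \<alpha> coroot gs br gen"
    and "\<Lambda> \<in> dual hs"
    and "lie_module gs br vs act"
    and "simple_module vs act"
    and "highest_weight_module I gen vs act \<Lambda>"
  shows "wt hs gen vs act =
    (convex hull (wt hs gen vs act)) \<inter> {\<mu> \<in> dual hs. weight_le I \<alpha> \<mu> \<Lambda>}"
proof -
  obtain v where v: "v \<noteq> 0" "v \<in> weight_space gen vs act \<Lambda>" "\<And>i. i \<in> I \<Longrightarrow> act (gen (E i)) v = 0"
      "\<And>W. submodule vs act W \<Longrightarrow> v \<in> W \<Longrightarrow> W = UNIV"
    using assms(5) unfolding highest_weight_module_def by blast
  interpret kac_moody_algebra I A hs \<alpha> coroot gs br gen by fact
  interpret M: lie_module gs br vs act by fact
  interpret simple_highest_weight_module I A hs \<alpha> coroot gs br gen vs act \<Lambda> v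
    by unfold_locales (use assms(2,4) v in auto)
  show ?thesis by (rule wt_saturated)
qed

end
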